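(* Let $Q=\mathrm{diag}(q_1,\dots,q_n)$, $q_i>0$, and let $P^l\in\mathbb{R}^n$ be constant. Define \[ \overline\theta=\frac{\mathbf{1}_n\mathbf{1}_n^TP^l}{\mathbf{1}_n^TQ^{-1}\mathbf{1}_n},\qquad \overline u=Q^{-1}\overline\theta. \] Suppose there exist $\overline\eta\in\mathcal{R}(D^T)\cap(-\frac{\pi}{2},\frac{\pi}{2})^m$ and $\overline V\in\mathbb{R}^n_{>0}$ with $\overline u-P^l=D\Gamma(\overline V)\boldsymbol{\sin}(\overline\eta)$ and $E(\overline\eta)\overline V=\overline E_{fd}$, and that $(\overline\eta,\overline V)$ satisfies condition $(\ast)$. Let $\mathcal{G}^{comm}$ be a connected undirected graph on $\{1,\dots,n\}$ (the communication graph), with neighbour sets $\mathcal{N}_i^{comm}$. Consider the network dynamics in closed loop with the controllers \[ \dot\theta_i=\sum_{j\in\mathcal{N}_i^{comm}}(\theta_j-\theta_i)-q_i^{-1}\omega_i,\qquad u_i=q_i^{-1}\theta_i,\qquad i=1,\dots,n. \] Then there is a neighbourhood of $(\overline\eta,\mathbf{0},\overline V,\overline\theta)$ such that every closed-loop solution starting in it converges asymptotically to the largest invariant set on which $\omega=\mathbf{0}$, $E(\eta)V-\overline E_{fd}=\mathbf{0}$ (so $V$ equals a constant $\tilde V$), and $\theta=\overline\theta$; on this set $\eta$ is a constant $\tilde\eta$ and $\mathbf{0}=\overline u-D\Gamma(\tilde V)\boldsymbol{\sin}(\tilde\eta)-P^l$, $\mathbf{0}=-E(\tilde\eta)\tilde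 V+\overline E_{fd}$. In particular the frequency deviation converges to zero and $u$ converges to the cost-minimizing generation $\overline u$.
   Context: Standing setup (power network model). $\mathcal{G}=(\mathcal{V},\mathcal{E})$ is a connected undirected graph with node set $\{1,\dots,n\}$ and $m$ edges; each edge $k=\{i,j\}$ is given an arbitrary orientation, and $D\in\mathbb{R}^{n\times m}$ is the incidence matrix: $d_{ik}=+1$ if $i$ is the positive end of edge $k$, $-1$ if $i$ is the negative end, $0$ otherwise. $|D|$ denotes the matrix of entrywise absolute values of $D$. $\mathbf{1}_n$ is the all-ones vector. For each edge $k=\{i,j\}$ there is a susceptance $B_{ij}=B_{ji}>0$; each node has a self-susceptance $B_{ii}<0$ with $|B_{ii}|>\sum_{j\in\mathcal{N}_i}|B_{ij}|$ ($\mathcal{N}_i$ the neighbours of $i$ in $\mathcal{G}$), and reactances $X_{di}>X'_{di}>0$. For $V\in\mathbb{R}^n$, $\Gamma(V)=\mathrm{diag}(\gamma_1,\dots,\gamma_m)$ with $\gamma_k=V_iV_jB_{ij}$ for edge $k=\{i,j\}$. For $\eta\in\mathbb{R}^m$, $E(\eta)\in\mathbb{R}^{n\times n}$ is the symmetric matrix with $E_{ii}=\frac{1-B_{ii}(X_{di}-X'_{di})}{X_{di}-X'_{di}}$, $E_{ij}=-B_{ij}\cos(\eta_k)$ if $k=\{i,j\}$ is an edge, and $E_{ij}=0$ otherwise. $\boldsymbol{\sin}$, $\boldsymbol{\cos}$ act componentwise. $M,A,T$ are diagonal positive definite $n\times n$ matrices ($A=\mathrm{diag}(A_i)$), and $\overline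 E_{fd}\in\mathbb{R}^n$ is a constant vector. The network dynamics, with input $u\in\mathbb{R}^n$ (power generation) and demand $P^l$, are \[ \dot\eta=D^T\omega,\quad M\dot\omega=u-D\Gamma(V)\boldsymbol{\sin}(\eta)-A\omega-P^l,\quad T\dot V=-E(\eta)V+\overline E_{fd},\quad y=\omega, \] with state $(\eta,\omega,V)\in\mathbb{R}^m\times\mathbb{R}^n\times\mathbb{R}^n$. Condition $(\ast)$ on $(\overline\eta,\overline V)$: \[ E(\overline\eta)-\mathrm{diag}(\overline V)^{-1}|D|\Gamma(\overline V)\mathrm{diag}(\boldsymbol{\sin}(\overline\eta))\mathrm{diag}(\boldsymbol{\cos}(\overline\eta))^{-1}\mathrm{diag}(\boldsymbol{\sin}(\overline\eta))|D|^T\mathrm{diag}(\overline V)^{-1}>0. \] *)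

theory Defs
  imports "HOL-Analysis.Analysis"
begin

text \<open>Graphs: node type 'n, edge type 'm; edge k has positive end src k and negative end dst k.\<close>

definition graph_connected :: "('a \<Rightarrow> 'a \<Rightarrow> bool) \<Rightarrow> bool" where
  "graph_connected adj \<longleftrightarrow> (\<forall>i j. (i, j) \<in> {(a, b). adj a b}\<^sup>*)"

definition edge_adj :: "('m \<Rightarrow> 'n) \<Rightarrow> ('m \<Rightarrow> 'n) \<Rightarrow> 'n \<Rightarrow> 'n \<Rightarrow> bool" where
  "edge_adj src dst i j \<longleftrightarrow> (\<exists>k. (src k = i \<and> dst k = j) \<or> (src k = j \<and> dst k = i))"

definition incidence :: "('m::finite \<Rightarrow> 'n::finite) \<Rightarrow> ('m \<Rightarrow> 'n) \<Rightarrow> real^'m^'n" where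
  "incidence src dst = (\<chi> i k. if i = src k then 1 else if i = dst k then -1 else 0)"

definition mat_abs :: "real^'c^'r \<Rightarrow> real^'c^'r" where
  "mat_abs X = (\<chi> i j. \<bar>X $ i $ j\<bar>)"

definition diag_mat :: "real^'n \<Rightarrow> real^'n^'n" where
  "diag_mat d = (\<chi> i j. if i = j then d $ i else 0)"

definition vsin :: "real^'m \<Rightarrow> real^'m" where
  "vsin x = (\<chi> k. sin (x $ k))"

definition vcos :: "real^'m \<Rightarrow> real^'m" where
  "vcos x = (\<chi> k. cos (x $ k))"

definition Gamma :: "('m::finite \<Rightarrow> 'n::finite) \<Rightarrow> ('m \<Rightarrow> 'n) \<Rightarrow> ('n \<Rightarrow> 'n \<Rightarrow> real)
    \<Rightarrow> real^'n \<Rightarrow> real^'m^'m" where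
  "Gamma src dst B V = diag_mat (\<chi> k. V $ src k * V $ dst k * B (src k) (dst k))"

definition Emat :: "('m::finite \<Rightarrow> 'n::finite) \<Rightarrow> ('m \<Rightarrow> 'n) \<Rightarrow> ('n \<Rightarrow> 'n \<Rightarrow> real)
    \<Rightarrow> ('n \<Rightarrow> real) \<Rightarrow> ('n \<Rightarrow> real) \<Rightarrow> real^'m \<Rightarrow> real^'n^'n" where
  "Emat src dst B Xd Xd' eta = (\<chi> i j.
     if i = j then (1 - B i i * (Xd i - Xd' i)) / (Xd i - Xd' i)
     else if (\<exists>k. {src k, dst k} = {i, j})
          then - B i j * cos (eta $ (SOME k. {src k, dst k} = {i, j}))
          else 0)"

definition pos_def :: "real^'n^'n \<Rightarrow> bool" where
  "pos_def A \<longleftrightarrow> transpose A = A \<and> (\<forall>x. x \<noteq> 0 \<longrightarrow> x \<bullet> (A *v x) > 0)"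

text \<open>Condition (*); inverses of diagonal matrices written as diagonal matrices of reciprocals.\<close>
definition cond_star :: "('m::finite \<Rightarrow> 'n::finite) \<Rightarrow> ('m \<Rightarrow> 'n) \<Rightarrow> ('n \<Rightarrow> 'n \<Rightarrow> real)
    \<Rightarrow> ('n \<Rightarrow> real) \<Rightarrow> ('n \<Rightarrow> real) \<Rightarrow> real^'m \<Rightarrow> real^'n \<Rightarrow> bool" where
  "cond_star src dst B Xd Xd' eta V \<longleftrightarrow>
     pos_def (Emat src dst B Xd Xd' eta
       - diag_mat (\<chi> i. 1 / V $ i) ** mat_abs (incidence src dst) ** Gamma src dst B V
         ** diag_mat (vsin eta) ** diag_mat (\<chi> k. 1 / cos (eta $ k)) ** diag_mat (vsin eta)
         ** transpose (mat_abs (incidence src dst)) ** diag_mat (\<chi> i. 1 / V $ i))"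

text \<open>Closed-loop vector field on states (eta, omega, V, theta); M, A, T diagonal with
  diagonals Mv, Av, Tv; controller u_i = theta_i / q_i.\<close>
definition cl_field :: "('m::finite \<Rightarrow> 'n::finite) \<Rightarrow> ('m \<Rightarrow> 'n) \<Rightarrow> ('n \<Rightarrow> 'n \<Rightarrow> real)
    \<Rightarrow> ('n \<Rightarrow> real) \<Rightarrow> ('n \<Rightarrow> real) \<Rightarrow> ('n \<Rightarrow> real) \<Rightarrow> ('n \<Rightarrow> real) \<Rightarrow> ('n \<Rightarrow> real)
    \<Rightarrow> real^'n \<Rightarrow> real^'n \<Rightarrow> ('n \<Rightarrow> 'n \<Rightarrow> bool) \<Rightarrow> ('n \<Rightarrow> real)
    \<Rightarrow> (real^'m) \<times> (real^'n) \<times> (real^'n) \<times> (real^'n) \<Rightarrow> (real^'m) \<times> (real^'n) \<times> (real^'n) \<times> (real^'n)" where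
  "cl_field src dst B Xd Xd' Mv Av Tv Efd Pl Ec q = (\<lambda>(eta, w, V, th).
     let D = incidence src dst; u = (\<chi> i. th $ i / q i) in
     (transpose D *v w,
      (\<chi> i. (u - D *v (Gamma src dst B V *v vsin eta) - (\<chi> j. Av j * w $ j) - Pl) $ i / Mv i),
      (\<chi> i. (Efd - Emat src dst B Xd Xd' eta *v V) $ i / Tv i),
      (\<chi> i. (\<Sum>j\<in>{j. Ec i j}. th $ j - th $ i) - w $ i / q i)))"

definition is_solution :: "('s::real_normed_vector \<Rightarrow> 's) \<Rightarrow> real set \<Rightarrow> (real \<Rightarrow> 's) \<Rightarrow> bool" where
  "is_solution f I x \<longleftrightarrow> is_interval I \<and> (\<forall>t\<in>I. (x has_vector_derivative f (x t)) (at t within I))"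

text \<open>Invariance (two-sided, as in LaSalle): every solution through a point of S stays in S
  on its whole interval of definition.\<close>
definition invariant_set :: "('s::real_normed_vector \<Rightarrow> 's) \<Rightarrow> 's set \<Rightarrow> bool" where
  "invariant_set f S \<longleftrightarrow>
     (\<forall>I x. 0 \<in> I \<and> is_solution f I x \<and> x 0 \<in> S \<longrightarrow> (\<forall>t\<in>I. x t \<in> S))"

definition largest_invariant_subset :: "('s::real_normed_vector \<Rightarrow> 's) \<Rightarrow> 's set \<Rightarrow> 's set" where
  "largest_invariant_subset f Z = \<Union>{S. S \<subseteq> Z \<and> invariant_set f S}"

end

theory Submission
  imports Defs
begin

text \<open>The physical energy, shifted by its linearisation at the equilibrium, plus
  \<open>\<bar>\<theta> - \<theta>bar\<bar>\<^sup>2 / 2\<close> is a Lyapunov function: along solutions its derivative is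
  \<open>- \<omega>\<^sup>T A \<omega> - (E V - Efd)\<^sup>T T\<^sup>-\<^sup>1 (E V - Efd) - \<theta>\<^sup>T L \<theta>\<close>, with \<open>L\<close> the Laplacian of the communication
  graph, and condition (*) is the Schur complement of its Hessian, so that the equilibrium is a strict
  local minimum and nearby solutions are trapped in a ball. Barbalat's lemma, applied first to the
  energy and then to \<open>\<omega>\<close>, shows that the vector field vanishes asymptotically along trapped solutions;
  summing the swing equations over all nodes identifies the limit of \<open>\<theta>\<close>. Hence solutions approach
  the set of equilibria, and each equilibrium is an invariant set by uniqueness of solutions.\<close>

section \<open>Ordinary differential equations\<close>

text \<open>Near the given equilibrium the equilibria need not be isolated: the balance equations
  fix the line flows only up to the kernel of \<open>D\<close>, so every independent cycle of the
  power graph adds a dimension. The equilibrium is still a strict minimum of the energy, because the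
  linear term compares flows line by line and not node by node. Hence trapping works in the full
  state space, while convergence is to a set and is measured by \<open>infdist\<close>. The largest
  invariant set is not computed; the distance to a subset of it, the rest points with
  \<open>\<omega> = 0\<close> and \<open>\<theta>\<close> at its equilibrium value, is shown to
  vanish and bounds the distance in question.

  Invariance quantifies over given solutions on arbitrary intervals. Therefore two facts about the
  equation are needed: a solution that meets a rest point never leaves it, in either time direction,
  and every point has some solution starting from it, without which invariance would yield no
  information about the points of an invariant set. The field is only locally Lipschitz, so
  existence for all times is obtained by truncating it outside a ball.\<close>

lemma integral_has_vector_derivative_atLeast:
  fixes h :: "real \<Rightarrow> 's::banach"
  assumes "continuous_on UNIV h" "a \<le> t"
  shows "((\<lambda>u. integral {a..u} h) has_vector_derivative h t) (at t within {a..})"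
proof -
  have "((\<lambda>u. integral {a..u} h) has_vector_derivative h t) (at t within {a..t+1})"
    using assms by (intro integral_has_vector_derivative) (auto intro: continuous_on_subset)
  moreover have "at t within {a..t+1} = at t within {a..}"
    by (rule at_within_nhd[of _ "{..<t+1}"]) auto
  ultimately show ?thesis by simp
qed

text \<open>Picard iteration for the rescaled curve \<open>y t = exp (- \<lambda> t) x t\<close> is a contraction on all
  of \<open>[0, \<infinity>)\<close> at once when \<open>\<lambda> \<ge> 2 L\<close>, so that no local solutions have to be glued.\<close>

lemma lipschitz_bounded_field_solution:
  fixes g :: "'s::banach \<Rightarrow> 's"
  assumes lip: "L-lipschitz_on UNIV g" and bd: "\<And>x. norm (g x) \<le> C"
  shows "\<exists>x. x 0 = p \<and> (\<forall>t\<ge>0. (x has_vector_derivative g (x t)) (at t within {0..}))"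
proof -
  have L0: "0 \<le> L" using lip by (rule lipschitz_on_nonneg)
  have C0: "0 \<le> C" using bd[of 0] norm_ge_zero order_trans by blast
  \<comment> \<open>The term \<open>2 * L\<close> makes the contraction factor \<open>L / l\<close>
    at most 1/2; the added 1 keeps \<open>l\<close> positive when \<open>L = 0\<close>.\<close>
  define l where "l = 2 * L + 1"
  have l0: "l > 0" using L0 by (simp add: l_def)
  define h where "h y s = g (exp (l * s) *\<^sub>R y s)" for y :: "real \<Rightarrow> 's" and s
  \<comment> \<open>Bounded continuous functions live on the whole real line here, so
    \<open>max 0 t\<close> extends the iterate by the constant \<open>p\<close> to negative
    times.\<close>
  define P where "P y t = exp (- l * max 0 t) *\<^sub>R (p + integral {0..max 0 t} (h y))"
    for y :: "real \<Rightarrow> 's" and t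
  have gc: "continuous_on UNIV g" using lip by (rule lipschitz_on_continuous_on)
  have hc: "continuous_on UNIV (h y)" if "continuous_on UNIV y" for y
    unfolding h_def
    by (rule continuous_on_compose2[OF gc]) (auto intro!: continuous_intros that)
  have hi: "h y integrable_on {a..b}" if "continuous_on UNIV y" for y a b
    by (rule integrable_continuous_real) (rule continuous_on_subset[OF hc[OF that]], simp)
  have Pb: "P y \<in> bcontfun" if y: "continuous_on UNIV y" for y
  proof (rule bcontfun_normI)
    have "continuous_on {0..} (\<lambda>u. integral {0..u} (h y))"
      using integral_has_vector_derivative_atLeast[OF hc[OF y], of 0]
      by (auto simp: continuous_on_eq_continuous_within
          intro!: has_vector_derivative_continuous)
    then have "continuous_on UNIV (\<lambda>t. integral {0..max 0 t} (h y))"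
      by (rule continuous_on_compose2[where f = "max 0"]) (auto intro!: continuous_intros)
    then show "continuous_on UNIV (P y)"
      unfolding P_def by (intro continuous_intros)
    fix t :: real
    define \<tau> where "\<tau> = max 0 t"
    have t0: "\<tau> \<ge> 0" by (simp add: \<tau>_def)
    have "norm (integral {0..\<tau>} (h y)) \<le> C * (\<tau> - 0)"
    proof (rule integral_bound)
      show "continuous_on {0..\<tau>} (h y)" by (rule continuous_on_subset[OF hc[OF y]]) simp
    qed (use t0 in \<open>auto simp: h_def bd\<close>)
    then have 1: "norm (p + integral {0..\<tau>} (h y)) \<le> norm p + C * \<tau>"
      using norm_triangle_ineq[of p "integral {0..\<tau>} (h y)"] by simp
    have e1: "exp (- l * \<tau>) \<le> 1" using l0 t0 by simp
    \<comment> \<open>The integral of a bounded field grows at most linearly, and the exponential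
      weight absorbs this growth.\<close>
    have "1 + l * \<tau> \<le> exp (l * \<tau>)" by (rule exp_ge_add_one_self)
    then have "l * \<tau> \<le> exp (l * \<tau>)" by linarith
    then have e2: "exp (- l * \<tau>) * \<tau> \<le> 1 / l"
      using l0 by (simp add: exp_minus field_simps)
    have "norm (P y t) = exp (- l * \<tau>) * norm (p + integral {0..\<tau>} (h y))"
      by (simp add: P_def \<tau>_def)
    also have "\<dots> \<le> exp (- l * \<tau>) * (norm p + C * \<tau>)"
      by (rule mult_left_mono[OF 1]) simp
    also have "\<dots> = exp (- l * \<tau>) * norm p + C * (exp (- l * \<tau>) * \<tau>)"
      by (simp add: algebra_simps)
    also have "\<dots> \<le> 1 * norm p + C * (1 / l)"
      by (intro add_mono mult_right_mono mult_left_mono e1 e2 C0) auto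
    finally show "norm (P y t) \<le> 1 * norm p + C * (1 / l)" .
  qed
  define F where "F y = Bcontfun (P (apply_bcontfun y))" for y :: "real \<Rightarrow>\<^sub>C 's"
  have F: "apply_bcontfun (F y) = P (apply_bcontfun y)" for y
    unfolding F_def by (rule Bcontfun_inverse) (rule Pb, simp)
  have contr: "dist (F y) (F z) \<le> (1/2) * dist y z" for y z
  proof (rule dist_bound)
    fix t :: real
    define \<tau> where "\<tau> = max 0 t"
    have t0: "\<tau> \<ge> 0" by (simp add: \<tau>_def)
    define d where "d = dist y z"
    have d0: "d \<ge> 0" by (simp add: d_def)
    have "((\<lambda>s. L * d * exp (l * s)) has_integral (L * d / l * exp (l * \<tau>) - L * d / l * exp (l * 0))) {0..\<tau>}"
      using t0 l0
      by (intro fundamental_theorem_of_calculus)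
        (auto intro!: derivative_eq_intros simp flip: has_real_derivative_iff_has_vector_derivative)
    then have I: "(\<lambda>s. L * d * exp (l * s)) integrable_on {0..\<tau>}"
        "integral {0..\<tau>} (\<lambda>s. L * d * exp (l * s)) = L * d / l * (exp (l * \<tau>) - 1)"
      by (auto simp: has_integral_iff algebra_simps)
    have "norm (integral {0..\<tau>} (\<lambda>s. h y s - h z s)) \<le> integral {0..\<tau>} (\<lambda>s. L * d * exp (l * s))"
    proof (rule integral_norm_bound_integral)
      show "(\<lambda>s. h y s - h z s) integrable_on {0..\<tau>}"
        by (intro integrable_diff hi) auto
      show "norm (h y s - h z s) \<le> L * d * exp (l * s)" for s
      proof -
        have "norm (h y s - h z s) \<le> L * norm (exp (l * s) *\<^sub>R y s - exp (l * s) *\<^sub>R z s)"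
          unfolding h_def using lipschitz_on_normD[OF lip] by blast
        also have "\<dots> = L * (exp (l * s) * dist (y s) (z s))"
          by (simp add: dist_norm flip: scaleR_diff_right)
        also have "\<dots> \<le> L * (exp (l * s) * d)"
          unfolding d_def by (intro mult_left_mono dist_bounded L0) simp
        finally show ?thesis by (simp add: algebra_simps)
      qed
    qed (rule I)
    also note I(2)
    finally have 1: "norm (integral {0..\<tau>} (h y) - integral {0..\<tau>} (h z)) \<le> L * d / l * (exp (l * \<tau>) - 1)"
      by (subst (asm) integral_diff) (auto intro: hi)
    have "dist (F y t) (F z t) = exp (- l * \<tau>) * norm (integral {0..\<tau>} (h y) - integral {0..\<tau>} (h z))"
      by (simp add: F P_def dist_norm flip: \<tau>_def scaleR_diff_right)
    also have "\<dots> \<le> exp (- l * \<tau>) * (L * d / l * (exp (l * \<tau>) - 1))"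
      by (rule mult_left_mono[OF 1]) simp
    also have "\<dots> = L * d / l * (1 - exp (- l * \<tau>))"
      by (simp add: algebra_simps exp_minus)
    also have "\<dots> \<le> L * d / l * 1"
      using L0 d0 l0 by (intro mult_left_mono) auto
    also have "\<dots> \<le> (1/2) * d"
      using L0 d0 by (simp add: l_def field_simps)
    finally show "dist (F y t) (F z t) \<le> (1/2) * dist y z" by (simp add: d_def)
  qed
  obtain y where y: "F y = y"
    using banach_fix_type[of "1/2" F] contr by auto
  define x where "x t = p + integral {0..t} (h y)" for t
  have xy: "x t = exp (l * t) *\<^sub>R y t" if "t \<ge> 0" for t
  proof -
    have "y t = exp (- (l * t)) *\<^sub>R x t"
      using that fun_cong[OF F[of y], of t] unfolding y P_def x_def by simp
    then have "exp (l * t) *\<^sub>R y t = (exp (l * t) * exp (- (l * t))) *\<^sub>R x t"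
      by simp
    also have "exp (l * t) * exp (- (l * t)) = 1"
      by (rule exp_minus_inverse)
    finally show ?thesis by simp
  qed
  show ?thesis
  proof (intro exI conjI allI impI)
    show "x 0 = p" by (simp add: x_def)
    fix t :: real assume t: "0 \<le> t"
    have "(x has_vector_derivative h y t) (at t within {0..})"
      unfolding x_def
      by (rule derivative_eq_intros integral_has_vector_derivative_atLeast[OF hc] refl t | simp)+
    then show "(x has_vector_derivative g (x t)) (at t within {0..})"
      using xy[OF t] by (simp add: h_def)
  qed
qed

section \<open>Maps that are Lipschitz on every ball\<close>

text \<open>Global Lipschitz continuity is lost under products, and the field contains products of
  voltages. Lipschitz continuity on each ball survives all operations used in the model. It serves
  two ends: solvability of the equation, and the uniform continuity in time that Barbalat's lemma
  asks of a quantity along a bounded curve.\<close>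

definition lipschitz_on_balls :: "('a::real_normed_vector \<Rightarrow> 'b::real_normed_vector) \<Rightarrow> bool" where
  "lipschitz_on_balls f \<longleftrightarrow> (\<forall>r. \<exists>L. L-lipschitz_on (cball 0 r) f)"

lemma lipschitz_on_ballsD:
  assumes "lipschitz_on_balls f" "bounded S"
  obtains L where "L-lipschitz_on S f"
proof -
  from \<open>bounded S\<close> obtain r where "S \<subseteq> cball 0 r"
    using bounded_subset_ballD[of S 0] ball_subset_cball by blast
  then show thesis using assms(1) that lipschitz_on_subset unfolding lipschitz_on_balls_def by metis
qed

lemma lipschitz_on_balls_continuous:
  assumes "lipschitz_on_balls f"
  shows "continuous_on S f"
proof -
  have "isCont f x" for x
  proof -
    obtain L where "L-lipschitz_on (ball x 1) f"
      using assms bounded_ball by (rule lipschitz_on_ballsD)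
    then have "continuous_on (ball x 1) f" by (rule lipschitz_on_continuous_on)
    then show ?thesis by (simp add: continuous_on_eq_continuous_at)
  qed
  then show ?thesis by (simp add: continuous_at_imp_continuous_on)
qed

lemma lipschitz_on_balls_const: "lipschitz_on_balls (\<lambda>x. c)"
  unfolding lipschitz_on_balls_def using lipschitz_on_constant by blast

lemma lipschitz_on_balls_linear:
  assumes "bounded_linear f"
  shows "lipschitz_on_balls f"
  using bounded_linear.lipschitz_boundE[OF assms] lipschitz_on_subset[OF _ subset_UNIV]
  unfolding lipschitz_on_balls_def by metis

text \<open>The outer map is globally Lipschitz, so the image of the ball under \<open>f\<close>
  never has to be bounded. This covers sine, cosine and linear maps.\<close>

lemma lipschitz_on_balls_compose:
  assumes "lipschitz_on_balls f" "L-lipschitz_on UNIV g"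
  shows "lipschitz_on_balls (\<lambda>x. g (f x))"
  unfolding lipschitz_on_balls_def
proof
  fix r
  obtain K where "K-lipschitz_on (cball 0 r) f"
    using assms(1) by (auto simp: lipschitz_on_balls_def)
  then have "(L * K)-lipschitz_on (cball 0 r) (\<lambda>x. g (f x))"
    by (rule lipschitz_on_compose2) (rule lipschitz_on_subset[OF assms(2) subset_UNIV])
  then show "\<exists>L. L-lipschitz_on (cball 0 r) (\<lambda>x. g (f x))" ..
qed

lemma lipschitz_on_balls_add:
  assumes "lipschitz_on_balls f" "lipschitz_on_balls g"
  shows "lipschitz_on_balls (\<lambda>x. f x + g x)"
  unfolding lipschitz_on_balls_def
proof
  fix r
  obtain K L where "K-lipschitz_on (cball 0 r) f" "L-lipschitz_on (cball 0 r) g"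
    using assms unfolding lipschitz_on_balls_def by meson
  from lipschitz_on_add[OF this]
  show "\<exists>L. L-lipschitz_on (cball 0 r) (\<lambda>x. f x + g x)" ..
qed

lemma lipschitz_on_balls_diff:
  assumes "lipschitz_on_balls f" "lipschitz_on_balls g"
  shows "lipschitz_on_balls (\<lambda>x. f x - g x)"
  unfolding lipschitz_on_balls_def
proof
  fix r
  obtain K L where "K-lipschitz_on (cball 0 r) f" "L-lipschitz_on (cball 0 r) g"
    using assms unfolding lipschitz_on_balls_def by meson
  from lipschitz_on_diff[OF this]
  show "\<exists>L. L-lipschitz_on (cball 0 r) (\<lambda>x. f x - g x)" ..
qed

lemma lipschitz_on_balls_Pair:
  assumes "lipschitz_on_balls f" "lipschitz_on_balls g"
  shows "lipschitz_on_balls (\<lambda>x. (f x, g x))"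
  unfolding lipschitz_on_balls_def
proof
  fix r
  obtain K L where "K-lipschitz_on (cball 0 r) f" "L-lipschitz_on (cball 0 r) g"
    using assms unfolding lipschitz_on_balls_def by meson
  from lipschitz_on_Pair[OF this]
  show "\<exists>L. L-lipschitz_on (cball 0 r) (\<lambda>x. (f x, g x))" ..
qed

lemma lipschitz_on_balls_sum:
  assumes "\<And>i. i \<in> A \<Longrightarrow> lipschitz_on_balls (f i)"
  shows "lipschitz_on_balls (\<lambda>x. \<Sum>i\<in>A. f i x)"
  using assms
  by (induction A rule: infinite_finite_induct)
    (auto intro: lipschitz_on_balls_const lipschitz_on_balls_add)

lemma lipschitz_on_balls_mult:
  fixes f g :: "'a::real_normed_vector \<Rightarrow> 'b::real_normed_algebra"
  assumes "lipschitz_on_balls f" "lipschitz_on_balls g"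
  shows "lipschitz_on_balls (\<lambda>x. f x * g x)"
  unfolding lipschitz_on_balls_def
proof
  fix r :: real
  show "\<exists>M. M-lipschitz_on (cball 0 r) (\<lambda>x. f x * g x)"
  proof (cases "r \<ge> 0")
    case False
    then have "0-lipschitz_on (cball 0 r) (\<lambda>x. f x * g x)" by simp
    then show ?thesis ..
  next
    case True
    obtain K L where K: "K-lipschitz_on (cball 0 r) f" and L: "L-lipschitz_on (cball 0 r) g"
      using assms unfolding lipschitz_on_balls_def by meson
    have K0: "K \<ge> 0" "L \<ge> 0" using K L lipschitz_on_nonneg by blast+
    \<comment> \<open>Bounds for \<open>f\<close> and \<open>g\<close> on the ball, by comparison
      with the value at its centre; \<open>r \<ge> 0\<close> puts the centre into the ball.\<close>
    define a b where "a = norm (f 0) + K * r" and "b = norm (g 0) + L * r"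
    have ab: "a \<ge> 0" "b \<ge> 0" using K0 True by (auto simp: a_def b_def)
    have a: "norm (f x) \<le> a" if "norm x \<le> r" for x :: 'a
    proof -
      have "norm (f x - f 0) \<le> K * norm (x - 0)" using that True by (intro lipschitz_on_normD[OF K]) auto
      also have "\<dots> \<le> K * r" using that K0 by (auto intro: mult_left_mono)
      finally show ?thesis unfolding a_def using norm_triangle_sub[of "f x" "f 0"] by linarith
    qed
    have b: "norm (g x) \<le> b" if "norm x \<le> r" for x :: 'a
    proof -
      have "norm (g x - g 0) \<le> L * norm (x - 0)" using that True by (intro lipschitz_on_normD[OF L]) auto
      also have "\<dots> \<le> L * r" using that K0 by (auto intro: mult_left_mono)
      finally show ?thesis unfolding b_def using norm_triangle_sub[of "g x" "g 0"] by linarith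
    qed
    have "(a * L + b * K)-lipschitz_on (cball 0 r) (\<lambda>x. f x * g x)"
    proof (rule lipschitz_onI)
      fix x y :: 'a assume xy: "x \<in> cball 0 r" "y \<in> cball 0 r"
      have "f x * g x - f y * g y = f x * (g x - g y) + (f x - f y) * g y"
        by (simp add: algebra_simps)
      also have "norm \<dots> \<le> norm (f x) * norm (g x - g y) + norm (f x - f y) * norm (g y)"
        by (rule norm_triangle_le) (intro add_mono norm_mult_ineq)
      also have "\<dots> \<le> a * (L * norm (x - y)) + (K * norm (x - y)) * b"
      proof (intro add_mono mult_mono)
        show "norm (g x - g y) \<le> L * norm (x - y)" by (rule lipschitz_on_normD[OF L xy])
        show "norm (f x - f y) \<le> K * norm (x - y)" by (rule lipschitz_on_normD[OF K xy])
      qed (use xy a[of x] b[of y] ab K0 in simp_all)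
      also have "\<dots> = (a * L + b * K) * dist x y"
        by (simp only: dist_norm) (simp add: algebra_simps)
      finally show "dist (f x * g x) (f y * g y) \<le> (a * L + b * K) * dist x y"
        by (simp only: dist_norm)
    next
      show "0 \<le> a * L + b * K"
        by (intro add_nonneg_nonneg mult_nonneg_nonneg ab K0)
    qed
    then show ?thesis ..
  qed
qed

lemma scaleR_axis: "c *\<^sub>R axis i (1::real) = axis i c"
  by (simp add: vec_eq_iff axis_def)

lemma lipschitz_on_balls_vec:
  fixes f :: "'a::real_normed_vector \<Rightarrow> 'i::finite \<Rightarrow> real"
  assumes "\<And>i. lipschitz_on_balls (\<lambda>x. f x i)"
  shows "lipschitz_on_balls (\<lambda>x. \<chi> i. f x i)"
proof -
  have "lipschitz_on_balls (\<lambda>x. axis i (f x i))" for i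
  proof -
    have "bounded_linear (\<lambda>c::real. c *\<^sub>R axis i (1::real) :: real^'i)"
      by (rule bounded_linear_scaleR_left)
    then obtain B where "B-lipschitz_on UNIV (\<lambda>c::real. c *\<^sub>R axis i (1::real) :: real^'i)"
      by (rule bounded_linear.lipschitz_boundE)
    from lipschitz_on_balls_compose[OF assms[of i] this] show ?thesis
      by (simp add: scaleR_axis)
  qed
  then have "lipschitz_on_balls (\<lambda>x. \<Sum>i\<in>UNIV. axis i (f x i))"
    by (intro lipschitz_on_balls_sum)
  moreover have "(\<Sum>i\<in>UNIV. axis i (f x i)) = (\<chi> i. f x i)" for x
    by (simp add: vec_eq_iff axis_def)
  ultimately show ?thesis by simp
qed

lemma sin_lipschitz: "1-lipschitz_on UNIV (sin :: real \<Rightarrow> real)"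
proof (rule lipschitz_onI)
  show "dist (sin x) (sin y) \<le> 1 * dist x y" for x y :: real
    using field_differentiable_bound[of UNIV sin cos 1 x y]
    by (auto simp: dist_norm has_field_derivative_at_within DERIV_sin abs_cos_le_one)
qed simp

lemma cos_lipschitz: "1-lipschitz_on UNIV (cos :: real \<Rightarrow> real)"
proof (rule lipschitz_onI)
  show "dist (cos x) (cos y) \<le> 1 * dist x y" for x y :: real
    using field_differentiable_bound[of UNIV cos "\<lambda>x. - sin x" 1 x y]
    by (auto simp: dist_norm has_field_derivative_at_within DERIV_cos abs_sin_le_one)
qed simp

lemmas lipschitz_on_balls_intros =
  lipschitz_on_balls_const lipschitz_on_balls_add lipschitz_on_balls_diff lipschitz_on_balls_mult
  lipschitz_on_balls_sum lipschitz_on_balls_Pair lipschitz_on_balls_vec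
  lipschitz_on_balls_compose[OF _ sin_lipschitz] lipschitz_on_balls_compose[OF _ cos_lipschitz]

section \<open>Existence by truncation, uniqueness at rest points\<close>

text \<open>Composing \<open>f\<close> with the nearest-point map of the ball, which is 1-Lipschitz,
  gives a bounded, globally Lipschitz field that agrees with \<open>f\<close> on the ball. The curve
  therefore exists for all times and obeys the original equation whenever it lies in the ball; that
  it never leaves is a matter for the energy.\<close>

lemma truncated_solution_exists:
  fixes f :: "'s::euclidean_space \<Rightarrow> 's"
  assumes "lipschitz_on_balls f" "r > 0"
  shows "\<exists>x. x 0 = p \<and> (\<forall>t\<ge>0. \<exists>v. (x has_vector_derivative v) (at t within {0..}) \<and>
    (x t \<in> cball c r \<longrightarrow> v = f (x t)))"
proof -
  define g where "g z = f (closest_point (cball c r) z)" for z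
  obtain L where L: "L-lipschitz_on (cball c r) f"
    using assms(1) bounded_cball by (rule lipschitz_on_ballsD)
  have mem: "closest_point (cball c r) z \<in> cball c r" for z
    using assms(2) by (intro closest_point_in_set) auto
  have "1-lipschitz_on UNIV (closest_point (cball c r))"
    using assms(2) by (intro lipschitz_onI) (auto intro!: closest_point_lipschitz)
  then have lip: "(L * 1)-lipschitz_on UNIV g"
    unfolding g_def
    by (rule lipschitz_on_compose2) (rule lipschitz_on_subset[OF L], use mem in auto)
  have "compact (f ` cball c r)"
    by (intro compact_continuous_image compact_cball lipschitz_on_balls_continuous assms(1))
  then obtain C where C: "\<And>z. z \<in> cball c r \<Longrightarrow> norm (f z) \<le> C"
    by (meson bounded_iff compact_imp_bounded imageI)
  obtain x where "x 0 = p" "\<forall>t\<ge>0. (x has_vector_derivative g (x t)) (at t within {0..})"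
    using lipschitz_bounded_field_solution[OF lip, of C p] C mem by (auto simp: g_def)
  then show ?thesis by (intro exI[of _ x]) (auto simp: g_def closest_point_self)
qed

text \<open>Uniqueness for the constant solution. The times with \<open>x t = p\<close> form a
  subset of the interval that is closed by continuity and open by a local contraction estimate,
  hence all of it by connectedness; past and future are treated alike.\<close>

lemma equilibrium_invariant:
  assumes f: "lipschitz_on_balls f" and p: "f p = 0"
  shows "invariant_set f {p}"
  unfolding invariant_set_def
proof (intro allI impI ballI, elim conjE)
  fix I :: "real set" and x and t
  assume I0: "0 \<in> I" and sol: "is_solution f I x" and x0: "x 0 \<in> {p}" and t: "t \<in> I"
  have iv: "is_interval I" and der: "\<And>t. t \<in> I \<Longrightarrow> (x has_vector_derivative f (x t)) (at t within I)"
    using sol by (auto simp: is_solution_def)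
  have cont: "continuous_on I x"
    by (auto simp: continuous_on_eq_continuous_within intro: has_vector_derivative_continuous der)
  obtain L where L: "L-lipschitz_on (ball p 1) f"
    using f bounded_ball by (rule lipschitz_on_ballsD)
  have L0: "L \<ge> 0" using L by (rule lipschitz_on_nonneg)
  define E where "E = {t \<in> I. x t = p}"
  have "closedin (top_of_set I) E"
    unfolding E_def by (rule continuous_closedin_preimage_constant[OF cont])
  moreover have "openin (top_of_set I) E"
    unfolding openin_euclidean_subtopology_iff
  proof (intro conjI ballI)
    show "E \<subseteq> I" by (auto simp: E_def)
    fix s assume "s \<in> E"
    then have s: "s \<in> I" "x s = p" by (auto simp: E_def)
    obtain d where d: "d > 0" "\<And>u. u \<in> I \<Longrightarrow> dist u s < d \<Longrightarrow> dist (x u) p < 1"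
      using cont s unfolding continuous_on_iff by (metis zero_less_one)
    \<comment> \<open>The first bound keeps \<open>x u\<close> in the unit ball, where
      \<open>L\<close> is valid; the second makes \<open>L * h\<close> at most 1/2.\<close>
    define h where "h = min (d / 2) (1 / (2 * (L + 1)))"
    have h: "h > 0" "h < d" "L * h \<le> 1 / 2"
    proof -
      show "h > 0" "h < d" using d(1) L0 by (auto simp: h_def)
      have "L * h \<le> L * (1 / (2 * (L + 1)))"
        unfolding h_def by (intro mult_left_mono L0) auto
      also have "\<dots> \<le> 1 / 2" using L0 by (simp add: field_simps)
      finally show "L * h \<le> 1 / 2" .
    qed
    define J where "J = {u \<in> I. \<bar>u - s\<bar> \<le> h}"
    have JI: "J \<subseteq> I" by (auto simp: J_def)
    have "J = I \<inter> cbox (s - h) (s + h)" by (auto simp: J_def abs_le_iff)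
    then have cJ: "convex J"
      using iv by (simp add: convex_Int convex_box is_interval_convex_1)
    \<comment> \<open>Largest distance from \<open>p\<close> over the short interval. The mean value
      estimate below gives \<open>M \<le> M / 2\<close>, so \<open>M\<close> cannot be
      positive.\<close>
    define M where "M = (SUP u\<in>J. norm (x u - p))"
    have near: "norm (x u - p) < 1" if "u \<in> J" for u
      using that d(2)[of u] h by (auto simp: J_def dist_norm)
    have bdd: "bdd_above ((\<lambda>u. norm (x u - p)) ` J)"
      using near less_imp_le by (intro bdd_aboveI2[where M = 1]) blast
    have up: "norm (x u - p) \<le> M" if "u \<in> J" for u
      unfolding M_def by (rule cSUP_upper[OF that bdd])
    have sJ: "s \<in> J" using s h by (auto simp: J_def)
    have half: "norm (x u - p) \<le> M / 2" if u: "u \<in> J" for u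
    proof -
      have "norm (x u - x s) \<le> (L * M) * norm (u - s)"
      proof (rule differentiable_bound[OF cJ _ _ u sJ])
        fix v assume v: "v \<in> J"
        show "(x has_derivative (\<lambda>h. h *\<^sub>R f (x v))) (at v within J)"
          using has_vector_derivative_within_subset[OF der[of v] JI] v JI
          by (auto simp: has_vector_derivative_def)
        have "norm (f (x v) - f p) \<le> L * norm (x v - p)"
          using near[OF v] by (intro lipschitz_on_normD[OF L]) (auto simp: dist_norm norm_minus_commute)
        also have "\<dots> \<le> L * M" by (intro mult_left_mono up v L0)
        finally have "norm (f (x v)) \<le> L * M" by (simp add: p)
        then show "onorm (\<lambda>h. h *\<^sub>R f (x v)) \<le> L * M"
          by (intro onorm_le) (auto simp: mult.commute intro: mult_left_mono)
      qed
      also have "\<dots> \<le> (L * M) * h"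
        using u up[OF sJ] L0 by (intro mult_left_mono) (auto simp: J_def s)
      also have "\<dots> = (L * h) * M" by simp
      also have "\<dots> \<le> 1 / 2 * M"
        using up[OF sJ] by (intro mult_right_mono h(3)) (auto simp: s)
      finally show ?thesis by (simp add: s)
    qed
    have "(SUP u\<in>J. norm (x u - p)) \<le> M / 2"
      using sJ half by (intro cSUP_least) auto
    then have "M \<le> M / 2" by (simp flip: M_def)
    then have "x u = p" if "u \<in> J" for u
      using order_trans[OF norm_ge_zero up[OF that]] up[OF that] by auto
    then show "\<exists>e>0. \<forall>u\<in>I. dist u s < e \<longrightarrow> u \<in> E"
      using h(1) by (intro exI[of _ h]) (auto simp: E_def J_def dist_real_def)
  qed
  ultimately have "E = {} \<or> E = I"
    using is_interval_connected[OF iv] unfolding connected_clopen by blast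
  moreover have "0 \<in> E" using I0 x0 by (auto simp: E_def)
  ultimately show "x t \<in> {p}" using t by (auto simp: E_def)
qed

section \<open>Barbalat's lemma and trapping by a decreasing function\<close>

text \<open>Over a step \<open>h\<close> the increment of \<open>\<phi>\<close> equals
  \<open>h *\<^sub>R \<psi> t\<close> up to an error of at most \<open>K * h\<^sup>2\<close>. When
  \<open>\<phi>\<close> converges, its increments over a fixed step tend to zero, which makes
  \<open>\<psi>\<close> eventually small up to \<open>K * h\<close>.\<close>

lemma barbalat:
  fixes \<phi> \<psi> :: "real \<Rightarrow> 'a::real_normed_vector"
  assumes der: "\<And>t. t \<ge> 0 \<Longrightarrow> (\<phi> has_vector_derivative \<psi> t) (at t within {0..})"
    and lip: "K-lipschitz_on {0..} \<psi>"
    and lim: "(\<phi> \<longlongrightarrow> l) at_top"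
  shows "(\<psi> \<longlongrightarrow> 0) at_top"
proof (rule tendstoI)
  fix e :: real assume e: "e > 0"
  have K0: "K \<ge> 0" using lip by (rule lipschitz_on_nonneg)
  \<comment> \<open>This keeps \<open>K * h\<close> below \<open>e / 2\<close>. The other half of
    \<open>e\<close> is left to the increment of \<open>\<phi>\<close>, whence the tolerance
    \<open>h * e / 4\<close> at each of its two ends.\<close>
  define h where "h = e / (2 * (K + 1))"
  have h: "h > 0" "K * h < e / 2" using e K0 by (auto simp: h_def field_simps)
  have ev: "\<forall>\<^sub>F t in at_top. dist (\<phi> t) l < h * e / 4"
    using lim e h by (intro tendstoD) auto
  then obtain T where T: "\<And>t. t \<ge> T \<Longrightarrow> dist (\<phi> t) l < h * e / 4"
    by (auto simp: eventually_at_top_linorder)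
  show "\<forall>\<^sub>F t in at_top. dist (\<psi> t) 0 < e"
    using eventually_ge_at_top[of "max 0 T"]
  proof eventually_elim
    fix t assume "max 0 T \<le> t"
    then have t: "t \<ge> 0" "t \<ge> T" by auto
    have "norm (\<phi> (t + h) - \<phi> t - (t + h - t) *\<^sub>R \<psi> t) \<le> norm (t + h - t) * (K * h)"
    proof (rule vector_differentiable_bound_linearization[where S = "{t..t+h}"])
      fix u assume u: "u \<in> {t..t+h}"
      show "(\<phi> has_vector_derivative \<psi> u) (at u within {t..t+h})"
        using has_vector_derivative_within_subset[OF der[of u], of "{t..t+h}"] u t by auto
      have "norm (\<psi> u - \<psi> t) \<le> K * norm (u - t)"
        using u t by (intro lipschitz_on_normD[OF lip]) auto
      also have "\<dots> \<le> K * h" using u K0 by (intro mult_left_mono) auto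
      finally show "norm (\<psi> u - \<psi> t) \<le> K * h" .
    qed (use h in \<open>auto simp: closed_segment_eq_real_ivl\<close>)
    then have 1: "norm (\<phi> (t + h) - \<phi> t - h *\<^sub>R \<psi> t) \<le> h * (K * h)"
      using h by simp
    have "dist (\<phi> (t + h)) (\<phi> t) < h * e / 4 + h * e / 4"
      using T[of t] T[of "t + h"] t h by (intro dist_triangle_less_add[where y = l]) auto
    then have 2: "norm (\<phi> (t + h) - \<phi> t) < h * (e / 2)" by (simp add: dist_norm mult.commute)
    have "h * norm (\<psi> t) = norm (h *\<^sub>R \<psi> t)" using h by simp
    also have "\<dots> \<le> norm (\<phi> (t + h) - \<phi> t) + norm (\<phi> (t + h) - \<phi> t - h *\<^sub>R \<psi> t)"
      using norm_triangle_ineq4[of "\<phi> (t + h) - \<phi> t" "\<phi> (t + h) - \<phi> t - h *\<^sub>R \<psi> t"] by simp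
    also have "\<dots> < h * (e / 2) + h * (K * h)" using 1 2 by simp
    also have "\<dots> = h * (e / 2 + K * h)" by (simp add: algebra_simps)
    also have "\<dots> \<le> h * e" using h by (intro mult_left_mono) auto
    finally show "dist (\<psi> t) 0 < e" using h by simp
  qed
qed

lemma has_vector_derivative_nonpos_imp_le:
  fixes g :: "real \<Rightarrow> real"
  assumes "a \<le> b" "\<And>t. t \<in> J \<Longrightarrow> (g has_vector_derivative g' t) (at t within J)"
    "\<And>t. g' t \<le> 0" "{a..b} \<subseteq> J"
  shows "g b \<le> g a"
proof (cases "a = b")
  case False
  then have "a < b" using assms(1) by simp
  moreover have "(g has_derivative (\<lambda>h. h *\<^sub>R g' t)) (at t within {a..b})" if "a \<le> t" "t \<le> b" for t
  proof -
    have "t \<in> J" using that assms(4) by auto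
    then show ?thesis
      using has_vector_derivative_within_subset[OF assms(2) assms(4)]
      by (simp add: has_vector_derivative_def)
  qed
  ultimately have "\<exists>u\<in>{a<..<b}. g b - g a = (b - a) *\<^sub>R g' u" by (rule mvt_simple)
  then obtain u where "g b - g a = (b - a) * g' u" by auto
  also have "\<dots> \<le> 0" using assms(1,3) by (simp add: mult_nonneg_nonpos)
  finally show ?thesis by simp
qed simp

lemma antimono_bounded_tendsto:
  fixes g :: "real \<Rightarrow> real"
  assumes mono: "\<And>s t. a \<le> s \<Longrightarrow> s \<le> t \<Longrightarrow> g t \<le> g s" and bd: "\<And>t. a \<le> t \<Longrightarrow> c \<le> g t"
  shows "\<exists>l. (g \<longlongrightarrow> l) at_top"
proof -
  define l where "l = (INF t\<in>{a..}. g t)"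
  have bb: "bdd_below (g ` {a..})" using bd by (intro bdd_belowI2[where m = c]) auto
  have "(g \<longlongrightarrow> l) at_top"
  proof (rule decreasing_tendsto)
    show "\<forall>\<^sub>F t in at_top. l \<le> g t"
      using eventually_ge_at_top[of a]
      by eventually_elim (auto simp: l_def intro!: cINF_lower bb)
    fix y assume "l < y"
    then obtain s where s: "s \<ge> a" "g s < y"
      unfolding l_def using bb by (subst (asm) cINF_less_iff) auto
    show "\<forall>\<^sub>F t in at_top. g t < y"
      using eventually_ge_at_top[of s]
    proof eventually_elim
      fix t assume "s \<le> t"
      then have "g t \<le> g s" by (rule mono[OF s(1)])
      then show "g t < y" using s(2) by linarith
    qed
  qed
  then show ?thesis ..
qed

text \<open>The vanishing of \<open>h\<close> along the curve is obtained from Barbalat-type arguments; this replaces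
  the \<open>\<omega>\<close>-limit sets of LaSalle's principle.\<close>

lemma infdist_zero_set_tendsto:
  fixes x :: "real \<Rightarrow> 's::heine_borel" and h :: "'s \<Rightarrow> real"
  assumes "compact K" "\<And>t. t \<ge> a \<Longrightarrow> x t \<in> K" "continuous_on K h"
    and nn: "\<And>y. h y \<ge> 0" and lim: "((\<lambda>t. h (x t)) \<longlongrightarrow> 0) at_top"
  shows "((\<lambda>t. infdist (x t) {y. h y = 0}) \<longlongrightarrow> 0) at_top"
proof (rule tendstoI)
  fix e :: real assume e: "e > 0"
  define C where "C = {y \<in> K. infdist y {y. h y = 0} \<ge> e}"
  have "closed {y. infdist y {y. h y = 0} \<ge> e}"
    by (intro closed_Collect_le continuous_intros)
  then have C: "compact C"
    using compact_Int_closed[OF assms(1)] by (simp add: C_def Collect_conj_eq)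
  \<comment> \<open>A zero of \<open>h\<close> has distance 0 from the zero set and so is not in
    \<open>C\<close>; by compactness \<open>h\<close> is bounded away from 0 on \<open>C\<close>. If
    \<open>C\<close> is empty, any \<open>m\<close> will do.\<close>
  have "\<exists>m>0. \<forall>y\<in>C. m \<le> h y"
  proof (cases "C = {}")
    case True
    then show ?thesis by (auto intro: exI[of _ 1])
  next
    case False
    have "continuous_on C h" by (rule continuous_on_subset[OF assms(3)]) (auto simp: C_def)
    then obtain z where z: "z \<in> C" "\<And>y. y \<in> C \<Longrightarrow> h z \<le> h y"
      using continuous_attains_inf[OF C False] by blast
    have "h z \<noteq> 0"
    proof
      assume "h z = 0"
      then have "infdist z {y. h y = 0} = 0" by simp
      then show False using z(1) e by (simp add: C_def)
    qed
    then show ?thesis using z nn[of z] by (intro exI[of _ "h z"]) auto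
  qed
  then obtain m where m: "m > 0" "\<And>y. y \<in> C \<Longrightarrow> m \<le> h y" by blast
  have "\<forall>\<^sub>F t in at_top. h (x t) < m" using order_tendstoD(2)[OF lim m(1)] .
  with eventually_ge_at_top[of a]
  show "\<forall>\<^sub>F t in at_top. dist (infdist (x t) {y. h y = 0}) 0 < e"
  proof eventually_elim
    fix t assume "a \<le> t" "h (x t) < m"
    then have "x t \<notin> C" using m(2)[of "x t"] by auto
    then show "dist (infdist (x t) {y. h y = 0}) 0 < e"
      using assms(2)[OF \<open>a \<le> t\<close>] infdist_nonneg[of "x t"] by (auto simp: C_def)
  qed
qed

text \<open>At the first time outside the open ball the curve is on the sphere, and up to that time
  it solves the true equation, so \<open>W\<close> has not increased; this contradicts
  \<open>sub\<close>. The hypothesis \<open>der\<close> has the form that truncation produces and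
  that a genuine solution satisfies as well, so the same statement serves both the existence of
  solutions and the behaviour of all of them.\<close>

lemma trapped_in_ball:
  fixes x :: "real \<Rightarrow> 's::euclidean_space" and W :: "'s \<Rightarrow> real"
  assumes der: "\<And>t. t \<ge> 0 \<Longrightarrow> \<exists>v. (x has_vector_derivative v) (at t within {0..}) \<and>
      (x t \<in> cball c r \<longrightarrow> v = f (x t))"
    and W: "\<And>I x t. is_solution f I x \<Longrightarrow> t \<in> I \<Longrightarrow>
      ((\<lambda>t. W (x t)) has_vector_derivative N (x t)) (at t within I)"
    and N: "\<And>y. N y \<le> 0"
    and x0: "x 0 \<in> ball c r" and sub: "\<And>y. y \<in> sphere c r \<Longrightarrow> W (x 0) < W y"
    and T: "T \<ge> 0"
  shows "x T \<in> ball c r"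
proof (rule ccontr)
  assume out: "x T \<notin> ball c r"
  have cont: "continuous_on {0..} x"
    unfolding continuous_on_eq_continuous_within
  proof
    fix t :: real assume "t \<in> {0..}"
    then obtain v where "(x has_vector_derivative v) (at t within {0..})"
      using der[of t] by auto
    then show "continuous (at t within {0..}) x" by (rule has_vector_derivative_continuous)
  qed
  \<comment> \<open>Times up to \<open>T\<close> spent outside the open ball: a compact set, whose
    least element is the exit time.\<close>
  define S where "S = {0..T} \<inter> x -` (- ball c r)"
  have "closed S" unfolding S_def
    by (intro continuous_closed_preimage continuous_on_subset[OF cont] closed_Compl open_ball
        closed_atLeastAtMost) (simp add: atLeastAtMost_def)
  moreover have "bounded S"
    by (rule bounded_subset[OF bounded_closed_interval[of 0 T]]) (simp add: S_def)
  ultimately have "compact S" by (simp add: compact_eq_bounded_closed)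
  moreover have "T \<in> S" using out T by (simp add: S_def)
  then have "S \<noteq> {}" by blast
  ultimately obtain s where s: "s \<in> S" "\<And>u. u \<in> S \<Longrightarrow> s \<le> u"
    using compact_attains_inf[of S] by metis
  have s0: "s \<ge> 0" using s by (auto simp: S_def)
  have sout: "dist c (x s) \<ge> r" using s by (auto simp: S_def)
  have "s \<noteq> 0" using x0 sout by auto
  then have sp: "s > 0" using s0 by simp
  have ins: "x u \<in> ball c r" if "0 \<le> u" "u < s" for u
  proof (rule ccontr)
    assume "x u \<notin> ball c r"
    then have "u \<in> S" using that s by (simp add: S_def)
    then show False using s(2)[of u] that by simp
  qed
  have "x s \<in> closure (ball c r)"
  proof -
    have "continuous_on (closure {0..<s}) x"
      using sp by (simp add: closure_atLeastLessThan) (rule continuous_on_subset[OF cont], auto)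
    then have "x ` closure {0..<s} \<subseteq> closure (ball c r)"
    proof (rule image_closure_subset)
      show "x ` {0..<s} \<subseteq> closure (ball c r)"
        using ins closure_subset[of "ball c r"] by (auto simp del: mem_ball)
    qed simp
    then show ?thesis using sp by (auto simp: closure_atLeastLessThan)
  qed
  then have xs: "x s \<in> cball c r" using closure_minimal[OF ball_subset_cball closed_cball] by blast
  then have sph: "x s \<in> sphere c r" using sout by auto
  have sol: "is_solution f {0..s} x"
    unfolding is_solution_def
  proof (intro conjI ballI)
    show "is_interval {0..s}" by (rule is_interval_cc)
    fix t assume t: "t \<in> {0..s}"
    then have "x t \<in> cball c r" using ins[of t] xs by (cases "t = s") auto
    then show "(x has_vector_derivative f (x t)) (at t within {0..s})"
    proof -
      obtain v where v: "(x has_vector_derivative v) (at t within {0..})" "x t \<in> cball c r \<longrightarrow> v = f (x t)"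
        using der[of t] t by auto
      then have "v = f (x t)" using \<open>x t \<in> cball c r\<close> by blast
      moreover have "(x has_vector_derivative v) (at t within {0..s})"
        by (rule has_vector_derivative_within_subset[OF v(1)]) auto
      ultimately show ?thesis by simp
    qed
  qed
  have "W (x s) \<le> W (x 0)"
    using s0 N W[OF sol]
    by (intro has_vector_derivative_nonpos_imp_le[where J = "{0..s}" and g = "\<lambda>t. W (x t)"
        and g' = "\<lambda>t. N (x t)"]) simp_all
  then show False using sub[OF sph] by simp
qed

lemma lipschitz_on_balls_divide_const:
  fixes f :: "'a::real_normed_vector \<Rightarrow> real"
  assumes "lipschitz_on_balls f"
  shows "lipschitz_on_balls (\<lambda>x. f x / c)"
  using lipschitz_on_balls_mult[OF assms lipschitz_on_balls_const[of "1 / c"]] by simp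

lemma lipschitz_on_balls_uminus:
  assumes "lipschitz_on_balls f"
  shows "lipschitz_on_balls (\<lambda>x. - f x)"
  using lipschitz_on_balls_diff[OF lipschitz_on_balls_const[of 0] assms] by simp

lemma lipschitz_on_balls_if:
  assumes "lipschitz_on_balls f" "lipschitz_on_balls g"
  shows "lipschitz_on_balls (\<lambda>x. if P then f x else g x)"
  using assms by (cases P) simp_all

text \<open>The field is bounded on the ball, and a bound for the speed is a Lipschitz constant of
  the curve. With \<open>lipschitz_on_balls_comp_curve\<close> this makes the energy rate and the
  field Lipschitz in time.\<close>

lemma solution_lipschitz:
  fixes f :: "'s::euclidean_space \<Rightarrow> 's"
  assumes f: "lipschitz_on_balls f" and sol: "is_solution f {0..} x"
    and bd: "\<And>t. t \<ge> 0 \<Longrightarrow> x t \<in> cball c r"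
  shows "\<exists>K. K-lipschitz_on {0..} x"
proof -
  have "compact (f ` cball c r)"
    by (intro compact_continuous_image compact_cball lipschitz_on_balls_continuous f)
  then obtain C where C: "\<And>z. z \<in> cball c r \<Longrightarrow> norm (f z) \<le> C"
    by (meson bounded_iff compact_imp_bounded imageI)
  have "C-lipschitz_on {0..} x"
  proof (rule lipschitz_onI)
    fix s t :: real assume st: "s \<in> {0..}" "t \<in> {0..}"
    have "norm (x s - x t) \<le> C * norm (s - t)"
    proof (rule differentiable_bound[OF _ _ _ st])
      fix u :: real assume u: "u \<in> {0..}"
      show "(x has_derivative (\<lambda>h. h *\<^sub>R f (x u))) (at u within {0..})"
        using sol u by (simp add: is_solution_def has_vector_derivative_def)
      show "onorm (\<lambda>h. h *\<^sub>R f (x u)) \<le> C"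
      proof (rule onorm_le)
        fix h :: real
        show "norm (h *\<^sub>R f (x u)) \<le> C * norm h"
          using mult_right_mono[OF C[OF bd[of u]], of "norm h"] u by (simp add: mult.commute)
      qed
    qed simp
    then show "dist (x s) (x t) \<le> C * dist s t" by (simp only: dist_norm)
  next
    show "0 \<le> C" using C[OF bd[of 0]] norm_ge_zero order_trans by blast
  qed
  then show ?thesis ..
qed

lemma lipschitz_on_balls_comp_curve:
  assumes h: "lipschitz_on_balls h" and x: "K-lipschitz_on {0::real..} x"
    and bd: "\<And>t. t \<ge> 0 \<Longrightarrow> x t \<in> cball c r"
  shows "\<exists>L. L-lipschitz_on {0..} (\<lambda>t. h (x t))"
proof -
  obtain M where "M-lipschitz_on (cball c r) h"
    using h bounded_cball by (rule lipschitz_on_ballsD)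
  then have "M-lipschitz_on (x ` {0..}) h"
    by (rule lipschitz_on_subset) (use bd in auto)
  from lipschitz_on_compose2[OF x this] show ?thesis ..
qed

section \<open>Second-order criteria for a strict minimum\<close>

text \<open>Applied along the segment from the equilibrium to a nearby point, this replaces a Taylor
  expansion in several variables: the slope starts at zero and increases.\<close>

lemma second_derivative_pos_imp_less:
  fixes g g' g'' :: "real \<Rightarrow> real"
  assumes "a < b"
    and g: "\<And>s. a \<le> s \<Longrightarrow> s \<le> b \<Longrightarrow> (g has_real_derivative g' s) (at s)"
    and g': "\<And>s. a \<le> s \<Longrightarrow> s \<le> b \<Longrightarrow> (g' has_real_derivative g'' s) (at s)"
    and "g' a = 0" and pos: "\<And>s. a \<le> s \<Longrightarrow> s \<le> b \<Longrightarrow> g'' s > 0"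
  shows "g a < g b"
proof (rule DERIV_pos_imp_increasing_open[OF \<open>a < b\<close>])
  fix s assume s: "a < s" "s < b"
  have "g' a < g' s"
  proof (rule DERIV_pos_imp_increasing[OF s(1)])
    fix u assume "a \<le> u" "u \<le> s"
    then show "\<exists>y. (g' has_real_derivative y) (at u) \<and> 0 < y"
      using g'[of u] pos[of u] s by (intro exI[of _ "g'' u"] conjI) simp_all
  qed
  then show "\<exists>y. (g has_real_derivative y) (at s) \<and> 0 < y"
    using g[of s] s \<open>g' a = 0\<close> by (intro exI[of _ "g' s"] conjI) simp_all
next
  show "continuous_on {a..b} g"
  proof (intro continuous_at_imp_continuous_on ballI)
    fix s assume "s \<in> {a..b}"
    then show "isCont g s" using DERIV_isCont[OF g[of s]] by simp
  qed
qed

text \<open>Compactness of the unit sphere makes positive definiteness an open condition.\<close>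

lemma positive_quadratic_open:
  fixes h :: "'x::topological_space \<times> 'd::euclidean_space \<Rightarrow> real"
  assumes cont: "continuous_on UNIV h"
    and hom: "\<And>x c d. h (x, c *\<^sub>R d) = c\<^sup>2 * h (x, d)"
    and pos: "\<And>d. d \<noteq> 0 \<Longrightarrow> h (x0, d) > 0"
  shows "\<exists>U. open U \<and> x0 \<in> U \<and> (\<forall>x\<in>U. \<forall>d. d \<noteq> 0 \<longrightarrow> h (x, d) > 0)"
proof -
  have "open {z. 0 < h z}"
    by (rule open_Collect_less[OF continuous_on_const cont])
  moreover have "{x0} \<times> sphere 0 1 \<subseteq> {z. 0 < h z}"
  proof
    fix z assume "z \<in> {x0} \<times> sphere (0::'d) 1"
    then have z: "z = (x0, snd z)" "norm (snd z) = 1" by auto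
    then have "snd z \<noteq> 0" by auto
    then show "z \<in> {z. 0 < h z}" using pos[of "snd z"] z(1) by simp
  qed
  \<comment> \<open>The tube lemma needs one compact factor, here the unit sphere of directions;
    homogeneity carries positivity over to all nonzero directions.\<close>
  ultimately obtain U where U: "x0 \<in> U" "open U" "U \<times> sphere 0 1 \<subseteq> {z. 0 < h z}"
    using Elementary_Topology.tube_lemma[OF compact_sphere[of 0 1], of "{z. 0 < h z}" x0] by metis
  have "h (x, d) > 0" if "x \<in> U" "d \<noteq> 0" for x d
  proof -
    have "(x, d /\<^sub>R norm d) \<in> U \<times> sphere 0 1" using that by simp
    then have "h (x, d /\<^sub>R norm d) > 0" using U(3) by blast
    moreover have "h (x, d) = (norm d)\<^sup>2 * h (x, d /\<^sub>R norm d)"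
      using hom[of x "norm d" "d /\<^sub>R norm d"] that by simp
    ultimately show ?thesis using that by simp
  qed
  then show ?thesis using U by blast
qed

section \<open>The network model\<close>

lemma sum_if_eq_add:
  fixes h :: "'n::finite \<Rightarrow> real"
  assumes "a \<noteq> b"
  shows "(\<Sum>i\<in>UNIV. (if i = a then h i else 0) + (if i = b then h' i else 0)) = h a + h' b"
  by (simp add: sum.distrib)

lemma transpose_incidence_mult:
  assumes "src k \<noteq> dst k"
  shows "(transpose (incidence src dst) *v w) $ k = w $ src k - w $ dst k"
proof -
  have "(transpose (incidence src dst) *v w) $ k =
    (\<Sum>i\<in>UNIV. (if i = src k then w $ i else 0) + (if i = dst k then - w $ i else 0))"
    unfolding matrix_vector_mult_def transpose_def incidence_def
    using assms by (auto intro!: sum.cong)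
  then show ?thesis by (simp add: sum_if_eq_add[OF assms])
qed

lemma transpose_abs_incidence_mult:
  assumes "src k \<noteq> dst k"
  shows "(transpose (mat_abs (incidence src dst)) *v w) $ k = w $ src k + w $ dst k"
proof -
  have "(transpose (mat_abs (incidence src dst)) *v w) $ k =
    (\<Sum>i\<in>UNIV. (if i = src k then w $ i else 0) + (if i = dst k then w $ i else 0))"
    unfolding matrix_vector_mult_def transpose_def incidence_def mat_abs_def
    using assms by (auto intro!: sum.cong)
  then show ?thesis by (simp add: sum_if_eq_add[OF assms])
qed

lemma diag_mat_mult: "(diag_mat d *v x) $ i = d $ i * x $ i"
  by (simp add: diag_mat_def matrix_vector_mult_def mult_delta_left)

lemma inner_matrix_mult_transpose:
  fixes X :: "real^'c^'r"
  shows "y \<bullet> (X *v x) = (transpose X *v y) \<bullet> x"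
  using dot_lmul_matrix[of y X x] by simp

locale power_network =
  fixes src dst :: "'m::finite \<Rightarrow> 'n::finite"
    and B :: "'n \<Rightarrow> 'n \<Rightarrow> real"
    and Xd Xd' Mv Av Tv q :: "'n \<Rightarrow> real"
    and Efd Pl Vbar :: "real^'n"
    and etabar :: "real^'m"
    and Ec :: "'n \<Rightarrow> 'n \<Rightarrow> bool"
  assumes no_loop: "src k \<noteq> dst k"
    and inj_edges: "inj (\<lambda>k. {src k, dst k})"
    and B_sym: "B i j = B j i"
    and B_edge: "edge_adj src dst i j \<Longrightarrow> B i j > 0"
    and pos: "Mv i > 0" "Av i > 0" "Tv i > 0" "q i > 0"
    and etabar: "- (pi / 2) < etabar $ k" "etabar $ k < pi / 2"
    and Vbar: "Vbar $ i > 0"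
    and power_balance: "(\<chi> i. (\<Sum>j\<in>UNIV. Pl $ j) / (\<Sum>j\<in>UNIV. 1 / q j) / q i) - Pl
      = incidence src dst *v (Gamma src dst B Vbar *v vsin etabar)"
    and voltage_balance: "Emat src dst B Xd Xd' etabar *v Vbar = Efd"
    and star: "cond_star src dst B Xd Xd' etabar Vbar"
    and Ec_sym: "Ec i j = Ec j i"
    and Ec_connected: "graph_connected Ec"
begin

abbreviation "field \<equiv> cl_field src dst B Xd Xd' Mv Av Tv Efd Pl Ec q"

section \<open>The model as sums over nodes and edges\<close>

text \<open>The common entry of the equilibrium value of \<open>\<theta>\<close>. It is the marginal
  cost, that is the Lagrange multiplier for minimising the sum of
  \<open>q i * (u i)\<^sup>2 / 2\<close> under the constraint that generation meets total
  demand.\<close>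

definition "price = (\<Sum>j\<in>UNIV. Pl $ j) / (\<Sum>j\<in>UNIV. 1 / q j)"

definition "b k = B (src k) (dst k)"

definition "F i = (1 - B i i * (Xd i - Xd' i)) / (Xd i - Xd' i)"

definition "inc i k = incidence src dst $ i $ k"

definition "flow e V k = V $ src k * V $ dst k * b k * sin (e $ k)"

text \<open>Coordinates of the vector \<open>E V\<close>, with an edge sum in place of matrix
  entries: each edge is listed once and acts on both of its ends. This form is free of the choice
  operator in \<open>Emat\<close> and can be differentiated term by term.\<close>

definition "EV e V i = F i * V $ i - (\<Sum>k\<in>UNIV. b k * cos (e $ k) *
  ((if i = src k then V $ dst k else 0) + (if i = dst k then V $ src k else 0)))"

lemma b_pos: "b k > 0"
  unfolding b_def by (rule B_edge) (auto simp: edge_adj_def)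

text \<open>A bridge between two descriptions: \<open>joins_iff\<close> matches the unordered pairs
  in \<open>Emat\<close>, while \<open>joins_delta\<close> splits the indicator into Kronecker
  deltas, on which sums over nodes collapse.\<close>

definition "joins k i j = (if i = src k \<and> j = dst k \<or> i = dst k \<and> j = src k then 1 else (0::real))"

lemma joins_iff: "joins k i j = (if {src k, dst k} = {i, j} then 1 else 0)"
  unfolding joins_def doubleton_eq_iff by (rule if_cong) auto

lemma joins_delta: "joins k i j = (if j = dst k then if i = src k then 1 else 0 else 0)
    + (if j = src k then if i = dst k then 1 else 0 else 0)"
  using no_loop[of k] by (cases "i = src k"; cases "i = dst k") (auto simp: joins_def)

text \<open>No two edges have the same ends, so the choice in \<open>Emat\<close> has a single
  candidate and the sum at most one nonzero term.\<close>

lemma Emat_offdiag: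
  assumes "i \<noteq> j"
  shows "Emat src dst B Xd Xd' e $ i $ j = - (\<Sum>k\<in>UNIV. b k * cos (e $ k) * joins k i j)"
proof (cases "\<exists>k. {src k, dst k} = {i, j}")
  case True
  then obtain k where k: "{src k, dst k} = {i, j}" by blast
  have u: "l = k" if "{src l, dst l} = {i, j}" for l
    by (rule injD[OF inj_edges]) (simp only: that k)
  have "(SOME l. {src l, dst l} = {i, j}) = k"
    by (rule some_equality[where P = "\<lambda>l. {src l, dst l} = {i, j}", OF k u])
  then have 1: "Emat src dst B Xd Xd' e $ i $ j = - B i j * cos (e $ k)"
    by (simp only: Emat_def vec_lambda_beta if_not_P[OF assms] if_P[OF True])
  have "src k = i \<and> dst k = j \<or> src k = j \<and> dst k = i"
    using k unfolding doubleton_eq_iff .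
  then have bk: "b k = B i j"
    unfolding b_def using B_sym by metis
  have "joins l i j = (if l = k then 1 else 0)" for l
    unfolding joins_iff using u[of l] k by metis
  then have "(\<Sum>l\<in>UNIV. b l * cos (e $ l) * joins l i j) = b k * cos (e $ k)"
    by (simp add: mult_delta_right)
  then show ?thesis unfolding 1 bk by simp
next
  case False
  then have "joins l i j = 0" for l
    unfolding joins_iff by metis
  moreover have "Emat src dst B Xd Xd' e $ i $ j = 0"
    by (simp only: Emat_def vec_lambda_beta if_not_P[OF assms] if_not_P[OF False])
  ultimately show ?thesis by simp
qed

lemma Emat_mult: "(Emat src dst B Xd Xd' e *v V) $ i = EV e V i"
proof -
  let ?E = "Emat src dst B Xd Xd' e"
  let ?h = "\<lambda>j k. b k * cos (e $ k) * joins k i j"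
  have "?E $ i $ j * V $ j = (if j = i then F i * V $ i else 0) - (\<Sum>k\<in>UNIV. ?h j k * V $ j)" for j
  proof (cases "i = j")
    case True
    have "joins k i j = 0" for k using True no_loop[of k] by (auto simp: joins_def)
    then show ?thesis using True by (simp add: Emat_def F_def)
  next
    case False
    have "?E $ i $ j * V $ j = - (\<Sum>k\<in>UNIV. ?h j k * V $ j)"
      unfolding Emat_offdiag[OF False] by (simp only: sum_distrib_right mult_minus_left)
    then show ?thesis using False by simp
  qed
  then have "(?E *v V) $ i = F i * V $ i - (\<Sum>j\<in>UNIV. \<Sum>k\<in>UNIV. ?h j k * V $ j)"
    unfolding matrix_vector_mult_def by (simp add: sum_subtractf)
  also have "(\<Sum>j\<in>UNIV. \<Sum>k\<in>UNIV. ?h j k * V $ j) = (\<Sum>k\<in>UNIV. \<Sum>j\<in>UNIV. ?h j k * V $ j)"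
    by (rule sum.swap)
  also have "\<dots> = (\<Sum>k\<in>UNIV. b k * cos (e $ k) *
    ((if i = src k then V $ dst k else 0) + (if i = dst k then V $ src k else 0)))"
  proof (rule sum.cong[OF refl])
    fix k
    have "(\<Sum>j\<in>UNIV. joins k i j * V $ j) =
      (if i = src k then V $ dst k else 0) + (if i = dst k then V $ src k else 0)"
      unfolding joins_delta by (simp add: distrib_right sum.distrib mult_delta_left)
    then show "(\<Sum>j\<in>UNIV. ?h j k * V $ j) = b k * cos (e $ k) *
      ((if i = src k then V $ dst k else 0) + (if i = dst k then V $ src k else 0))"
      by (simp add: mult.assoc flip: sum_distrib_left)
  qed
  finally show ?thesis by (simp add: EV_def)
qed

text \<open>The bilinear form of \<open>E\<close>, visibly symmetric in \<open>y\<close> and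
  \<open>V\<close>. It identifies the voltage part of the potential's derivative with the residual
  of the voltage equation.\<close>

lemma sum_mult_EV: "(\<Sum>i\<in>UNIV. y i * EV e V i) = (\<Sum>i\<in>UNIV. F i * y i * V $ i)
  - (\<Sum>k\<in>UNIV. b k * cos (e $ k) * (y (src k) * V $ dst k + y (dst k) * V $ src k))"
proof -
  have "(\<Sum>i\<in>UNIV. y i * (\<Sum>k\<in>UNIV. b k * cos (e $ k) *
      ((if i = src k then V $ dst k else 0) + (if i = dst k then V $ src k else 0))))
    = (\<Sum>i\<in>UNIV. \<Sum>k\<in>UNIV. b k * cos (e $ k) *
      ((if i = src k then y i * V $ dst k else 0) + (if i = dst k then y i * V $ src k else 0)))"
    unfolding sum_distrib_left by (intro sum.cong refl) (simp add: algebra_simps)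
  also have "\<dots> = (\<Sum>k\<in>UNIV. \<Sum>i\<in>UNIV. b k * cos (e $ k) *
      ((if i = src k then y i * V $ dst k else 0) + (if i = dst k then y i * V $ src k else 0)))"
    by (rule sum.swap)
  also have "\<dots> = (\<Sum>k\<in>UNIV. b k * cos (e $ k) * (y (src k) * V $ dst k + y (dst k) * V $ src k))"
    by (simp add: sum.distrib flip: sum_distrib_left)
  finally show ?thesis
    by (simp add: EV_def right_diff_distrib sum_subtractf mult.left_commute mult.assoc)
qed

lemma Gamma_mult: "(Gamma src dst B V *v vsin e) $ k = flow e V k"
  by (simp add: Gamma_def diag_mat_mult flow_def vsin_def b_def)

lemma incidence_mult: "(incidence src dst *v x) $ i = (\<Sum>k\<in>UNIV. inc i k * x $ k)"
  by (simp add: matrix_vector_mult_def inc_def)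

lemma sum_inc: "(\<Sum>i\<in>UNIV. y i * inc i k) = y (src k) - y (dst k)"
proof -
  have "(transpose (incidence src dst) *v (\<chi> i. y i)) $ k = (\<Sum>i\<in>UNIV. y i * inc i k)"
    by (simp add: matrix_vector_mult_def transpose_def inc_def mult.commute)
  then show ?thesis using transpose_incidence_mult[where src = src and dst = dst, OF no_loop[of k], of "\<chi> i. y i"] by simp
qed

text \<open>Summation by parts: \<open>D\<close> moves across the inner product as its transpose.
  For \<open>y = \<omega>\<close> it lets kinetic energy and line energy cancel; for constant
  \<open>y\<close> it says that line flows contribute nothing to the total power.\<close>

lemma sum_mult_sum_inc:
  "(\<Sum>i\<in>UNIV. y i * (\<Sum>k\<in>UNIV. inc i k * z k)) = (\<Sum>k\<in>UNIV. (y (src k) - y (dst k)) * z k)"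
proof -
  have "(\<Sum>i\<in>UNIV. y i * (\<Sum>k\<in>UNIV. inc i k * z k)) = (\<Sum>i\<in>UNIV. \<Sum>k\<in>UNIV. y i * inc i k * z k)"
    by (simp add: sum_distrib_left mult.assoc)
  also have "\<dots> = (\<Sum>k\<in>UNIV. \<Sum>i\<in>UNIV. y i * inc i k * z k)" by (rule sum.swap)
  finally show ?thesis by (simp add: sum_inc flip: sum_distrib_right)
qed

lemma field_eq: "field (e, w, V, th) =
  (\<chi> k. w $ src k - w $ dst k,
   \<chi> i. (th $ i / q i - (\<Sum>k\<in>UNIV. inc i k * flow e V k) - Av i * w $ i - Pl $ i) / Mv i,
   \<chi> i. (Efd $ i - EV e V i) / Tv i,
   \<chi> i. (\<Sum>j\<in>{j. Ec i j}. th $ j - th $ i) - w $ i / q i)"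
  unfolding cl_field_def
  by (simp del: transpose_matrix_vector add: vec_eq_iff transpose_incidence_mult[where src = src and dst = dst, OF no_loop] incidence_mult Gamma_mult Emat_mult)

lemma power_balance': "price / q i - Pl $ i = (\<Sum>k\<in>UNIV. inc i k * flow etabar Vbar k)"
  using arg_cong[OF power_balance, of "\<lambda>v. v $ i"]
  by (simp add: incidence_mult Gamma_mult price_def)

lemma voltage_balance': "EV etabar Vbar i = Efd $ i"
  using voltage_balance Emat_mult by metis

text \<open>Adding the copy with \<open>i\<close> and \<open>j\<close> exchanged, which symmetry of
  \<open>Ec\<close> permits, cancels \<open>a\<close> and leaves squares. The sum on the right runs
  over ordered pairs, so half of it is the usual Laplacian form.\<close>

lemma Laplacian_form:
  fixes y :: "'n \<Rightarrow> real"
  shows "(\<Sum>i\<in>UNIV. (y i - a) * (\<Sum>j\<in>{j. Ec i j}. y j - y i)) =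
    - (\<Sum>i\<in>UNIV. \<Sum>j\<in>{j. Ec i j}. (y j - y i)\<^sup>2) / 2"
proof -
  let ?c = "\<lambda>i j. if Ec i j then 1 else (0::real)"
  let ?S = "\<lambda>h. \<Sum>i\<in>UNIV. \<Sum>j\<in>UNIV. ?c i j * h i j"
  have conv: "(\<Sum>j\<in>{j. Ec i j}. h j) = (\<Sum>j\<in>UNIV. ?c i j * h j)" for i and h :: "'n \<Rightarrow> real"
    by (rule sum.mono_neutral_cong_left) auto
  have swap: "?S h = ?S (\<lambda>i j. h j i)" for h
    by (subst sum.swap) (simp add: Ec_sym)
  have L: "(\<Sum>i\<in>UNIV. (y i - a) * (\<Sum>j\<in>{j. Ec i j}. y j - y i)) = ?S (\<lambda>i j. (y i - a) * (y j - y i))"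
    by (simp add: conv sum_distrib_left mult.assoc mult.left_commute)
  have "2 * ?S (\<lambda>i j. (y i - a) * (y j - y i)) =
    ?S (\<lambda>i j. (y i - a) * (y j - y i)) + ?S (\<lambda>i j. (y j - a) * (y i - y j))"
    using swap[of "\<lambda>i j. (y i - a) * (y j - y i)"] by simp
  also have "\<dots> = ?S (\<lambda>i j. - ((y j - y i)\<^sup>2))"
    by (simp flip: sum.distrib add: algebra_simps power2_eq_square)
  also have "\<dots> = - ?S (\<lambda>i j. (y j - y i)\<^sup>2)"
    by (simp add: sum_negf)
  finally have "2 * ?S (\<lambda>i j. (y i - a) * (y j - y i)) = - ?S (\<lambda>i j. (y j - y i)\<^sup>2)" .
  then show ?thesis unfolding L by (simp add: conv)
qed

section \<open>The Lyapunov function\<close>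

text \<open>The quadratic part in \<open>V\<close> is one half of \<open>V^T E V\<close>. The
  gradient consists of the voltage residual and of the deviation of the line flows from their
  equilibrium values; both vanish at \<open>(etabar, Vbar)\<close>.\<close>

definition "potential e V = (\<Sum>i\<in>UNIV. F i * (V $ i)\<^sup>2 / 2 - Efd $ i * V $ i)
  - (\<Sum>k\<in>UNIV. b k * V $ src k * V $ dst k * cos (e $ k))
  - (\<Sum>k\<in>UNIV. flow etabar Vbar k * e $ k)"

text \<open>Up to an additive constant, \<open>energy\<close> is the Bregman distance of the physical energy from the
  equilibrium: the term linear in \<open>e\<close> makes the equilibrium a critical point.\<close>

definition "energy = (\<lambda>(e, w, V, th). (\<Sum>i\<in>UNIV. Mv i * (w $ i)\<^sup>2 / 2)
  + (\<Sum>i\<in>UNIV. (th $ i - price)\<^sup>2 / 2) + potential e V)"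

definition "rate = (\<lambda>(e, w, V, th). - (\<Sum>i\<in>UNIV. Av i * (w $ i)\<^sup>2)
  - (\<Sum>i\<in>UNIV. (Efd $ i - EV e V i)\<^sup>2 / Tv i)
  - (\<Sum>i\<in>UNIV. \<Sum>j\<in>{j. Ec i j}. (th $ j - th $ i)\<^sup>2) / 2)"

text \<open>Formulated along arbitrary curves because it is used both for solutions, with one-sided
  derivatives at the ends of \<open>I\<close>, and for straight rays.\<close>

lemma potential_has_derivative:
  assumes e: "\<And>k. ((\<lambda>t. e t $ k) has_real_derivative e' $ k) (at t within I)"
    and V: "\<And>i. ((\<lambda>t. V t $ i) has_real_derivative V' $ i) (at t within I)"
  shows "((\<lambda>t. potential (e t) (V t)) has_real_derivative
    (\<Sum>i\<in>UNIV. (EV (e t) (V t) i - Efd $ i) * V' $ i)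
    + (\<Sum>k\<in>UNIV. (flow (e t) (V t) k - flow etabar Vbar k) * e' $ k)) (at t within I)"
proof -
  let ?d = "(\<Sum>i\<in>UNIV. F i * V t $ i * V' $ i - Efd $ i * V' $ i)
    - (\<Sum>k\<in>UNIV. b k * cos (e t $ k) * (V' $ src k * V t $ dst k + V t $ src k * V' $ dst k)
        - flow (e t) (V t) k * e' $ k)
    - (\<Sum>k\<in>UNIV. flow etabar Vbar k * e' $ k)"
  have "((\<lambda>t. potential (e t) (V t)) has_real_derivative ?d) (at t within I)"
    unfolding potential_def
  proof (intro DERIV_diff DERIV_sum)
    fix i
    show "((\<lambda>t. F i * (V t $ i)\<^sup>2 / 2) has_real_derivative F i * V t $ i * V' $ i) (at t within I)"
      by (rule derivative_eq_intros V refl | simp)+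
    show "((\<lambda>t. Efd $ i * V t $ i) has_real_derivative Efd $ i * V' $ i) (at t within I)"
      by (intro DERIV_cmult V)
  next
    fix k
    have "((\<lambda>t. b k * V t $ src k * V t $ dst k * cos (e t $ k)) has_real_derivative
      b k * V t $ src k * V t $ dst k * (- sin (e t $ k) * e' $ k)
      + (b k * V t $ src k * V' $ dst k + b k * V' $ src k * V t $ dst k) * cos (e t $ k)) (at t within I)"
      by (intro DERIV_mult' DERIV_cmult V DERIV_chain2[OF DERIV_cos] e)
    then show "((\<lambda>t. b k * V t $ src k * V t $ dst k * cos (e t $ k)) has_real_derivative
      b k * cos (e t $ k) * (V' $ src k * V t $ dst k + V t $ src k * V' $ dst k)
        - flow (e t) (V t) k * e' $ k) (at t within I)"
      by (rule DERIV_cong) (simp add: flow_def algebra_simps)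
    show "((\<lambda>t. flow etabar Vbar k * e t $ k) has_real_derivative flow etabar Vbar k * e' $ k) (at t within I)"
      by (intro DERIV_cmult e)
  qed
  moreover have "?d = (\<Sum>i\<in>UNIV. (EV (e t) (V t) i - Efd $ i) * V' $ i)
    + (\<Sum>k\<in>UNIV. (flow (e t) (V t) k - flow etabar Vbar k) * e' $ k)"
  proof -
    have "(\<Sum>k\<in>UNIV. b k * cos (e t $ k) * (V' $ src k * V t $ dst k + V t $ src k * V' $ dst k)) =
      (\<Sum>i\<in>UNIV. F i * V t $ i * V' $ i) - (\<Sum>i\<in>UNIV. EV (e t) (V t) i * V' $ i)"
      using sum_mult_EV[of "\<lambda>i. V' $ i" "e t" "V t"] by (simp add: mult_ac)
    then show ?thesis
      by (simp add: sum_subtractf left_diff_distrib)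
  qed
  ultimately show ?thesis by simp
qed

text \<open>Two exchanges of power cancel: between swing equation and angles through
  \<open>D\<close>, and between swing equation and controllers through the terms in
  \<open>1 / q i\<close>. Only dissipation remains.\<close>

lemma energy_has_derivative:
  assumes "(x has_vector_derivative field (x t)) (at t within I)"
  shows "((\<lambda>t. energy (x t)) has_vector_derivative rate (x t)) (at t within I)"
proof -
  define e w V th where "e t = fst (x t)" and "w t = fst (snd (x t))"
    and "V t = fst (snd (snd (x t)))" and "th t = snd (snd (snd (x t)))" for t
  have x: "x t = (e t, w t, V t, th t)" for t
    by (simp add: e_def w_def V_def th_def)
  obtain e' w' V' th' where f: "field (x t) = (e', w', V', th')"
    by (metis prod.collapse)
  note fst' = bounded_linear.has_vector_derivative[OF bounded_linear_fst]
    and snd' = bounded_linear.has_vector_derivative[OF bounded_linear_snd]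
    and nth' = bounded_linear.has_vector_derivative[OF bounded_linear_vec_nth]
  note dx = assms[unfolded f]
  have e: "((\<lambda>t. e t $ k) has_real_derivative e' $ k) (at t within I)" for k
    using nth'[OF fst'[OF dx], of k]
    by (simp only: e_def fst_conv snd_conv has_real_derivative_iff_has_vector_derivative)
  have w: "((\<lambda>t. w t $ i) has_real_derivative w' $ i) (at t within I)" for i
    using nth'[OF fst'[OF snd'[OF dx]], of i]
    by (simp only: w_def fst_conv snd_conv has_real_derivative_iff_has_vector_derivative)
  have V: "((\<lambda>t. V t $ i) has_real_derivative V' $ i) (at t within I)" for i
    using nth'[OF fst'[OF snd'[OF snd'[OF dx]]], of i]
    by (simp only: V_def fst_conv snd_conv has_real_derivative_iff_has_vector_derivative)
  have th: "((\<lambda>t. th t $ i) has_real_derivative th' $ i) (at t within I)" for i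
    using nth'[OF snd'[OF snd'[OF snd'[OF dx]]], of i]
    by (simp only: th_def fst_conv snd_conv has_real_derivative_iff_has_vector_derivative)
  have f': "e' $ k = w t $ src k - w t $ dst k"
    "w' $ i = (th t $ i / q i - (\<Sum>k\<in>UNIV. inc i k * flow (e t) (V t) k) - Av i * w t $ i - Pl $ i) / Mv i"
    "V' $ i = (Efd $ i - EV (e t) (V t) i) / Tv i"
    "th' $ i = (\<Sum>j\<in>{j. Ec i j}. th t $ j - th t $ i) - w t $ i / q i" for i k
    using f unfolding x field_eq by auto
  define g where "g k = flow (e t) (V t) k - flow etabar Vbar k" for k
  define \<theta> where "\<theta> i = th t $ i" for i
  define \<omega> where "\<omega> i = w t $ i" for i
  define R where "R i = Efd $ i - EV (e t) (V t) i" for i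
  \<comment> \<open>Subtracting the equilibrium balance eliminates the demand and leaves the
    deviations of \<open>\<theta>\<close> and of the flows.\<close>
  have Mw: "Mv i * w' $ i = (\<theta> i - price) / q i - (\<Sum>k\<in>UNIV. inc i k * g k) - Av i * \<omega> i" for i
    using pos(1)[of i] power_balance'[of i]
    by (simp add: f' g_def \<theta>_def \<omega>_def right_diff_distrib sum_subtractf diff_divide_distrib)
  have "((\<lambda>t. energy (x t)) has_real_derivative
    (\<Sum>i\<in>UNIV. \<omega> i * (Mv i * w' $ i))
    + (\<Sum>i\<in>UNIV. (\<theta> i - price) * th' $ i)
    + ((\<Sum>i\<in>UNIV. (EV (e t) (V t) i - Efd $ i) * V' $ i)
    + (\<Sum>k\<in>UNIV. (flow (e t) (V t) k - flow etabar Vbar k) * e' $ k))) (at t within I)"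
    unfolding energy_def x prod.case
  proof (intro DERIV_add DERIV_sum potential_has_derivative[OF e V])
    fix i
    show "((\<lambda>t. Mv i * (w t $ i)\<^sup>2 / 2) has_real_derivative \<omega> i * (Mv i * w' $ i)) (at t within I)"
      unfolding \<omega>_def by (rule derivative_eq_intros w refl | simp)+
    show "((\<lambda>t. (th t $ i - price)\<^sup>2 / 2) has_real_derivative (\<theta> i - price) * th' $ i) (at t within I)"
      unfolding \<theta>_def by (rule derivative_eq_intros th refl | simp)+
  qed
  moreover have "(\<Sum>i\<in>UNIV. \<omega> i * (Mv i * w' $ i)) =
    (\<Sum>i\<in>UNIV. \<omega> i * (\<theta> i - price) / q i) - (\<Sum>k\<in>UNIV. (\<omega> (src k) - \<omega> (dst k)) * g k)
     - (\<Sum>i\<in>UNIV. Av i * (\<omega> i)\<^sup>2)"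
    unfolding sum_mult_sum_inc[symmetric] Mw sum_subtractf[symmetric]
    by (intro sum.cong refl) (simp add: algebra_simps power2_eq_square)
  moreover have "(\<Sum>i\<in>UNIV. (\<theta> i - price) * th' $ i) =
    - (\<Sum>i\<in>UNIV. \<Sum>j\<in>{j. Ec i j}. (\<theta> j - \<theta> i)\<^sup>2) / 2 - (\<Sum>i\<in>UNIV. \<omega> i * (\<theta> i - price) / q i)"
    unfolding Laplacian_form[of \<theta> price, symmetric] sum_subtractf[symmetric]
    by (intro sum.cong refl) (simp add: f' \<theta>_def \<omega>_def right_diff_distrib algebra_simps diff_divide_distrib)
  moreover have "(\<Sum>i\<in>UNIV. (EV (e t) (V t) i - Efd $ i) * V' $ i)
    = - (\<Sum>i\<in>UNIV. (R i)\<^sup>2 / Tv i)"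
    unfolding sum_negf[symmetric]
  proof (intro sum.cong refl)
    fix i
    have "EV (e t) (V t) i - Efd $ i = - R i" "V' $ i = R i / Tv i" by (simp_all add: R_def f')
    then show "(EV (e t) (V t) i - Efd $ i) * V' $ i = - ((R i)\<^sup>2 / Tv i)"
      by (simp add: power2_eq_square)
  qed
  moreover have "(\<Sum>k\<in>UNIV. (flow (e t) (V t) k - flow etabar Vbar k) * e' $ k)
    = (\<Sum>k\<in>UNIV. (\<omega> (src k) - \<omega> (dst k)) * g k)"
    by (intro sum.cong refl) (simp add: f' g_def \<omega>_def mult.commute)
  moreover have "rate (x t) = - (\<Sum>i\<in>UNIV. Av i * (\<omega> i)\<^sup>2) - (\<Sum>i\<in>UNIV. (R i)\<^sup>2 / Tv i)
    - (\<Sum>i\<in>UNIV. \<Sum>j\<in>{j. Ec i j}. (\<theta> j - \<theta> i)\<^sup>2) / 2"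
    by (simp add: rate_def x \<omega>_def R_def \<theta>_def)
  ultimately have "((\<lambda>t. energy (x t)) has_real_derivative rate (x t)) (at t within I)"
    by (elim DERIV_cong) linarith
  then show ?thesis
    by (simp only: has_real_derivative_iff_has_vector_derivative)
qed

lemma rate_terms_nonneg:
  "0 \<le> (\<Sum>i\<in>UNIV. Av i * (w $ i)\<^sup>2)" "0 \<le> (\<Sum>i\<in>UNIV. (y i)\<^sup>2 / Tv i)"
  "0 \<le> (\<Sum>i\<in>UNIV. \<Sum>j\<in>{j. Ec i j}. ((th :: real^'n) $ j - th $ i)\<^sup>2)"
  by (intro sum_nonneg mult_nonneg_nonneg divide_nonneg_nonneg zero_le_power2
      less_imp_le[OF pos(2)] less_imp_le[OF pos(3)])+

lemma rate_nonpos: "rate y \<le> 0"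
proof -
  obtain e w V th where "y = (e, w, V, th)" by (metis prod.collapse)
  then show ?thesis
    using rate_terms_nonneg(1)[of w] rate_terms_nonneg(2)[of "\<lambda>i. Efd $ i - EV e V i"]
      rate_terms_nonneg(3)[of th]
    by (simp add: rate_def)
qed

section \<open>Positive definiteness of the Hessian\<close>

text \<open>The second derivative of \<open>potential\<close> at \<open>(e, V)\<close> in the
  direction \<open>(a, v)\<close>, as \<open>potential_ray\<close> confirms.\<close>

definition "hess e V a v = (\<Sum>i\<in>UNIV. F i * (v $ i)\<^sup>2)
  + (\<Sum>k\<in>UNIV. b k * (2 * sin (e $ k) * (v $ src k * V $ dst k + V $ src k * v $ dst k) * a $ k
      + V $ src k * V $ dst k * cos (e $ k) * (a $ k)\<^sup>2 - 2 * v $ src k * v $ dst k * cos (e $ k)))"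

text \<open>The form of the matrix in \<open>cond_star\<close>: the transpose of \<open>|D|\<close>,
  applied after \<open>diag(V)^{-1}\<close>, adds the relative voltage changes at the two ends of an
  edge, and the factors between the two copies of \<open>|D|\<close> are diagonal.\<close>

lemma star_pos:
  assumes "v \<noteq> 0"
  shows "0 < (\<Sum>i\<in>UNIV. v $ i * EV etabar v i)
    - (\<Sum>k\<in>UNIV. Vbar $ src k * Vbar $ dst k * b k * (sin (etabar $ k))\<^sup>2 / cos (etabar $ k)
        * (v $ src k / Vbar $ src k + v $ dst k / Vbar $ dst k)\<^sup>2)"
proof -
  let ?X = "mat_abs (incidence src dst)" and ?p = "diag_mat (\<chi> i. 1 / Vbar $ i)"
  let ?G = "Gamma src dst B Vbar" and ?s = "diag_mat (vsin etabar)" and ?c = "diag_mat (\<chi> k. 1 / cos (etabar $ k))"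
  define y where "y = transpose ?X *v (?p *v v)"
  have y: "y $ k = v $ src k / Vbar $ src k + v $ dst k / Vbar $ dst k" for k
    unfolding y_def transpose_abs_incidence_mult[where src = src and dst = dst, OF no_loop]
    by (simp add: diag_mat_mult)
  have sym: "transpose ?p = ?p"
    by (auto simp: transpose_def diag_mat_def vec_eq_iff)
  have "0 < v \<bullet> ((Emat src dst B Xd Xd' etabar
      - ?p ** ?X ** ?G ** ?s ** ?c ** ?s ** transpose ?X ** ?p) *v v)"
    using star assms unfolding cond_star_def pos_def_def by blast
  also have "(Emat src dst B Xd Xd' etabar
      - ?p ** ?X ** ?G ** ?s ** ?c ** ?s ** transpose ?X ** ?p) *v v
    = Emat src dst B Xd Xd' etabar *v v - ?p *v (?X *v (?G *v (?s *v (?c *v (?s *v y)))))"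
    unfolding y_def by (simp only: matrix_vector_mult_diff_rdistrib matrix_vector_mul_assoc matrix_mul_assoc)
  also have "v \<bullet> \<dots> = v \<bullet> (Emat src dst B Xd Xd' etabar *v v) - y \<bullet> (?G *v (?s *v (?c *v (?s *v y))))"
    by (simp only: inner_diff_right inner_matrix_mult_transpose[of v] inner_matrix_mult_transpose[of "?p *v v"] sym y_def)
  also have "v \<bullet> (Emat src dst B Xd Xd' etabar *v v) = (\<Sum>i\<in>UNIV. v $ i * EV etabar v i)"
    by (simp add: inner_vec_def Emat_mult)
  also have "y \<bullet> (?G *v (?s *v (?c *v (?s *v y)))) = (\<Sum>k\<in>UNIV. Vbar $ src k * Vbar $ dst k * b k
    * (sin (etabar $ k))\<^sup>2 / cos (etabar $ k) * (y $ k)\<^sup>2)"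
    unfolding inner_vec_def
    by (intro sum.cong refl)
      (simp add: Gamma_def diag_mat_mult vsin_def b_def power2_eq_square mult_ac)
  finally show ?thesis unfolding y .
qed

text \<open>Completing the square in \<open>a\<close> leaves the Schur complement, which is the form in condition (*).\<close>

lemma hess_pos:
  assumes "(a, v) \<noteq> 0"
  shows "hess etabar Vbar a v > 0"
proof -
  have cos_pos: "cos (etabar $ k) > 0" for k
    using etabar[of k] by (intro cos_gt_zero_pi) auto
  have g_pos: "Vbar $ src k * Vbar $ dst k * b k > 0" for k
    by (intro mult_pos_pos Vbar b_pos)
  \<comment> \<open>First-order relative change of the product of the two end voltages; in this
    variable the mixed term of \<open>hess\<close> and the edge term of \<open>cond_star\<close>
    carry the same weight.\<close>
  define z where "z k = v $ src k / Vbar $ src k + v $ dst k / Vbar $ dst k" for k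
  have z: "v $ src k * Vbar $ dst k + Vbar $ src k * v $ dst k = Vbar $ src k * Vbar $ dst k * z k" for k
    using Vbar[of "src k"] Vbar[of "dst k"] by (simp add: z_def field_simps)
  define sq where "sq k = Vbar $ src k * Vbar $ dst k * b k * cos (etabar $ k)
    * (a $ k + sin (etabar $ k) / cos (etabar $ k) * z k)\<^sup>2" for k
  have sq0: "sq k \<ge> 0" for k
    using g_pos[of k] cos_pos[of k] by (simp add: sq_def)
  define Q where "Q = (\<Sum>i\<in>UNIV. v $ i * EV etabar v i)
    - (\<Sum>k\<in>UNIV. Vbar $ src k * Vbar $ dst k * b k * (sin (etabar $ k))\<^sup>2 / cos (etabar $ k) * (z k)\<^sup>2)"
  have "hess etabar Vbar a v = Q + (\<Sum>k\<in>UNIV. sq k)"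
  proof -
    have "b k * (2 * sin (etabar $ k) * (v $ src k * Vbar $ dst k + Vbar $ src k * v $ dst k) * a $ k
      + Vbar $ src k * Vbar $ dst k * cos (etabar $ k) * (a $ k)\<^sup>2 - 2 * v $ src k * v $ dst k * cos (etabar $ k))
      = sq k - Vbar $ src k * Vbar $ dst k * b k * (sin (etabar $ k))\<^sup>2 / cos (etabar $ k) * (z k)\<^sup>2
        - b k * cos (etabar $ k) * (v $ src k * v $ dst k + v $ dst k * v $ src k)" for k
    proof -
      have "cos (etabar $ k) \<noteq> 0" using cos_pos[of k] by simp
      then show ?thesis
        unfolding z sq_def by (simp add: field_simps power2_eq_square)
    qed
    then show ?thesis
      unfolding hess_def Q_def sum_mult_EV[of "\<lambda>i. v $ i"]
      by (simp add: sum.distrib sum_subtractf power2_eq_square mult.assoc)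
  qed
  moreover have "Q + (\<Sum>k\<in>UNIV. sq k) > 0"
  \<comment> \<open>For \<open>v = 0\<close> the Schur complement says nothing. The squares then
    reduce to those of the \<open>a $ k\<close>, whose weights are positive since the angles lie
    within a quarter turn of 0.\<close>
  proof (cases "v = 0")
    case False
    then have "Q > 0" using star_pos unfolding Q_def z_def by blast
    then show ?thesis using sq0 by (simp add: add_pos_nonneg sum_nonneg)
  next
    case True
    then obtain k where k: "a $ k \<noteq> 0" using assms by (auto simp: vec_eq_iff zero_prod_def)
    have "Q = 0" "z k = 0" using True by (simp_all add: Q_def z_def)
    moreover have "sq k > 0"
      using k g_pos[of k] cos_pos[of k] \<open>z k = 0\<close> by (simp add: sq_def)
    then have "(\<Sum>k\<in>UNIV. sq k) > 0" using sq0 by (intro sum_pos2[of _ k]) auto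
    ultimately show ?thesis by simp
  qed
  ultimately show ?thesis by simp
qed

text \<open>Positivity at the equilibrium alone would not do, since the second derivative is needed
  along whole segments.\<close>

lemma hess_pos_nbhd:
  "\<exists>U. open U \<and> (etabar, Vbar) \<in> U \<and>
    (\<forall>(e, V)\<in>U. \<forall>a v. (a, v) \<noteq> 0 \<longrightarrow> hess e V a v > 0)"
proof -
  define h :: "((real^'m) \<times> (real^'n)) \<times> ((real^'m) \<times> (real^'n)) \<Rightarrow> real"
    where "h z = hess (fst (fst z)) (snd (fst z)) (fst (snd z)) (snd (snd z))" for z
  have "continuous_on UNIV h"
    unfolding h_def hess_def by (intro continuous_intros)
  moreover have "h (x, c *\<^sub>R d) = c\<^sup>2 * h (x, d)" for x c d
  proof -
    show ?thesis
      unfolding h_def hess_def distrib_left sum_distrib_left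
      by (intro arg_cong2[where f = "(+)"] sum.cong refl)
       (simp_all add: power_mult_distrib algebra_simps power2_eq_square)
  qed
  ultimately have "\<exists>U. open U \<and> (etabar, Vbar) \<in> U \<and> (\<forall>x\<in>U. \<forall>d. d \<noteq> 0 \<longrightarrow> h (x, d) > 0)"
    by (rule positive_quadratic_open) (auto simp: h_def intro: hess_pos)
  then obtain U where "open U" "(etabar, Vbar) \<in> U" "\<And>x d. x \<in> U \<Longrightarrow> d \<noteq> 0 \<Longrightarrow> h (x, d) > 0"
    by blast
  then show ?thesis
    by (intro exI[of _ U]) (auto simp: h_def)
qed

lemma potential_ray:
  fixes e a :: "real^'m" and V v :: "real^'n"
  defines "p \<equiv> \<lambda>s::real. e + s *\<^sub>R a" and "P \<equiv> \<lambda>s::real. V + s *\<^sub>R v"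
  defines "g' \<equiv> \<lambda>s. (\<Sum>i\<in>UNIV. (EV (p s) (P s) i - Efd $ i) * v $ i)
    + (\<Sum>k\<in>UNIV. (flow (p s) (P s) k - flow etabar Vbar k) * a $ k)"
  shows "((\<lambda>s. potential (p s) (P s)) has_real_derivative g' s) (at s)"
    and "(g' has_real_derivative hess (p s) (P s) a v) (at s)"
proof -
  have p: "((\<lambda>s. p s $ k) has_real_derivative a $ k) (at s)" for k s
    unfolding p_def by (auto intro!: derivative_eq_intros)
  have P: "((\<lambda>s. P s $ i) has_real_derivative v $ i) (at s)" for i s
    unfolding P_def by (auto intro!: derivative_eq_intros)
  show "((\<lambda>s. potential (p s) (P s)) has_real_derivative g' s) (at s)"
    unfolding g'_def by (rule potential_has_derivative[OF p P])
  \<comment> \<open>Written out over nodes and edges, the slope can be differentiated summand by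
    summand.\<close>
  have g': "g' = (\<lambda>s. (\<Sum>i\<in>UNIV. F i * v $ i * P s $ i)
    - (\<Sum>k\<in>UNIV. b k * cos (p s $ k) * (v $ src k * P s $ dst k + v $ dst k * P s $ src k))
    - (\<Sum>i\<in>UNIV. Efd $ i * v $ i)
    + (\<Sum>k\<in>UNIV. (P s $ src k * P s $ dst k * b k * sin (p s $ k) - flow etabar Vbar k) * a $ k))"
    unfolding g'_def left_diff_distrib sum_subtractf
    using sum_mult_EV[of "\<lambda>i. v $ i"] by (simp add: flow_def mult.commute[of "EV _ _ _"])
  have 1: "((\<lambda>s. b k * cos (p s $ k) * (v $ src k * P s $ dst k + v $ dst k * P s $ src k)) has_real_derivative
     b k * cos (p s $ k) * (v $ src k * v $ dst k + v $ dst k * v $ src k)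
     + b k * (- sin (p s $ k) * a $ k) * (v $ src k * P s $ dst k + v $ dst k * P s $ src k)) (at s)" for k
    by (intro DERIV_mult' DERIV_cmult DERIV_add P DERIV_chain2[OF DERIV_cos] p)
  have 2: "((\<lambda>s. (P s $ src k * P s $ dst k * b k * sin (p s $ k) - flow etabar Vbar k) * a $ k) has_real_derivative
    (P s $ src k * P s $ dst k * b k * (cos (p s $ k) * a $ k)
      + (P s $ src k * v $ dst k + v $ src k * P s $ dst k) * b k * sin (p s $ k) - 0) * a $ k) (at s)" for k
    by (intro DERIV_mult' DERIV_cmult_right DERIV_diff DERIV_const P DERIV_chain2[OF DERIV_sin] p)
  have "(g' has_real_derivative (\<Sum>i\<in>UNIV. F i * v $ i * v $ i)
    - (\<Sum>k\<in>UNIV. b k * cos (p s $ k) * (v $ src k * v $ dst k + v $ dst k * v $ src k)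
       + b k * (- sin (p s $ k) * a $ k) * (v $ src k * P s $ dst k + v $ dst k * P s $ src k)) - 0
    + (\<Sum>k\<in>UNIV. (P s $ src k * P s $ dst k * b k * (cos (p s $ k) * a $ k)
      + (P s $ src k * v $ dst k + v $ src k * P s $ dst k) * b k * sin (p s $ k) - 0) * a $ k)) (at s)"
    unfolding g' by (intro DERIV_add DERIV_diff DERIV_sum DERIV_const DERIV_cmult P 1 2)
  moreover have "hess (p s) (P s) a v = (\<Sum>i\<in>UNIV. F i * v $ i * v $ i)
    - (\<Sum>k\<in>UNIV. b k * cos (p s $ k) * (v $ src k * v $ dst k + v $ dst k * v $ src k)
       + b k * (- sin (p s $ k) * a $ k) * (v $ src k * P s $ dst k + v $ dst k * P s $ src k)) - 0
    + (\<Sum>k\<in>UNIV. (P s $ src k * P s $ dst k * b k * (cos (p s $ k) * a $ k)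
      + (P s $ src k * v $ dst k + v $ src k * P s $ dst k) * b k * sin (p s $ k) - 0) * a $ k)"
  proof -
    have *: "x - y + z = x + w" if "w = z - y" for x y z w :: real using that by simp
    show ?thesis
      unfolding hess_def diff_0_right power2_eq_square mult.assoc
      by (rule sym, rule *, unfold sum_subtractf[symmetric], rule sum.cong[OF refl])
        (simp add: algebra_simps power2_eq_square)
  qed
  ultimately show "(g' has_real_derivative hess (p s) (P s) a v) (at s)" by simp
qed

lemma potential_min:
  "\<exists>r>0. \<forall>e V. dist (e, V) (etabar, Vbar) < r \<and> (e, V) \<noteq> (etabar, Vbar) \<longrightarrow>
    potential etabar Vbar < potential e V"
proof -
  obtain U where U: "open U" "(etabar, Vbar) \<in> U"
    "\<And>e V a v. (e, V) \<in> U \<Longrightarrow> (a, v) \<noteq> 0 \<Longrightarrow> hess e V a v > 0"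
    using hess_pos_nbhd by blast
  then obtain r where r: "r > 0" "ball (etabar, Vbar) r \<subseteq> U"
    using open_contains_ball by blast
  show ?thesis
  proof (intro exI conjI allI impI, rule r(1), elim conjE)
    fix e V assume d: "dist (e, V) (etabar, Vbar) < r" and ne: "(e, V) \<noteq> (etabar, Vbar)"
    define a v where "a = e - etabar" and "v = V - Vbar"
    have av: "(a, v) \<noteq> 0" using ne by (auto simp: a_def v_def zero_prod_def)
    define p P where "p s = etabar + s *\<^sub>R a" and "P s = Vbar + s *\<^sub>R v" for s :: real
    \<comment> \<open>Balls are convex, so the segment stays where the Hessian is positive.\<close>
    have inU: "(p s, P s) \<in> U" if "0 \<le> s" "s \<le> 1" for s
    proof -
      have "dist (p s, P s) (etabar, Vbar) = norm (s *\<^sub>R (a, v))"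
        by (simp add: dist_norm p_def P_def)
      also have "\<dots> = s * norm (a, v)" using that by (simp only: norm_scaleR abs_of_nonneg)
      also have "\<dots> \<le> 1 * norm (a, v)" by (rule mult_right_mono[OF that(2)]) simp
      also have "\<dots> < r" using d by (simp add: dist_norm a_def v_def)
      finally show ?thesis using r(2) by (auto simp: dist_commute)
    qed
    have "potential (p 0) (P 0) < potential (p 1) (P 1)"
    proof (rule second_derivative_pos_imp_less[where a = 0 and b = 1 and g = "\<lambda>s. potential (p s) (P s)"])
      show "((\<lambda>s. potential (p s) (P s)) has_real_derivative
        (\<Sum>i\<in>UNIV. (EV (p s) (P s) i - Efd $ i) * v $ i)
        + (\<Sum>k\<in>UNIV. (flow (p s) (P s) k - flow etabar Vbar k) * a $ k)) (at s)" for s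
        unfolding p_def P_def by (rule potential_ray)
      show "((\<lambda>s. (\<Sum>i\<in>UNIV. (EV (p s) (P s) i - Efd $ i) * v $ i)
        + (\<Sum>k\<in>UNIV. (flow (p s) (P s) k - flow etabar Vbar k) * a $ k))
        has_real_derivative hess (p s) (P s) a v) (at s)" for s
        unfolding p_def P_def by (rule potential_ray)
      \<comment> \<open>Both residuals vanish at the start of the segment: the equilibrium is
        critical.\<close>
      show "(\<Sum>i\<in>UNIV. (EV (p 0) (P 0) i - Efd $ i) * v $ i)
        + (\<Sum>k\<in>UNIV. (flow (p 0) (P 0) k - flow etabar Vbar k) * a $ k) = 0"
        by (simp add: p_def P_def voltage_balance')
      show "0 < hess (p s) (P s) a v" if "0 \<le> s" "s \<le> 1" for s
        using U(3)[OF inU[OF that] av] .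
    qed simp
    then show "potential etabar Vbar < potential e V"
      by (simp add: p_def P_def a_def v_def)
  qed
qed

definition "xbar = (etabar, 0 :: real^'n, Vbar, (\<chi> i. price) :: real^'n)"

lemma energy_min:
  "\<exists>r>0. \<forall>y. dist y xbar < r \<and> y \<noteq> xbar \<longrightarrow> energy xbar < energy y"
proof -
  obtain r where r: "r > 0" "\<And>e V. dist (e, V) (etabar, Vbar) < r \<Longrightarrow> (e, V) \<noteq> (etabar, Vbar) \<Longrightarrow>
      potential etabar Vbar < potential e V"
    using potential_min by blast
  define U where "U = (\<lambda>y :: (real^'m) \<times> (real^'n) \<times> (real^'n) \<times> (real^'n). (fst y, fst (snd (snd y)))) -` ball (etabar, Vbar) r"
  have "open U"
    unfolding U_def by (intro open_vimage open_ball continuous_intros)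
  moreover have "xbar \<in> U" using r(1) by (simp add: U_def xbar_def)
  ultimately obtain d where d: "d > 0" "ball xbar d \<subseteq> U"
    using open_contains_ball by blast
  show ?thesis
  proof (intro exI conjI allI impI, rule d(1), elim conjE)
    fix y assume y: "dist y xbar < d" "y \<noteq> xbar"
    obtain e w V th where [simp]: "y = (e, w, V, th)" by (metis prod.collapse)
    have "y \<in> U" using y(1) d(2) by (auto simp: dist_commute)
    then have near: "dist (e, V) (etabar, Vbar) < r" by (simp add: U_def dist_commute)
    have pot: "potential etabar Vbar \<le> potential e V"
      using r(2)[OF near] by (cases "(e, V) = (etabar, Vbar)") auto
    have w: "(\<Sum>i\<in>UNIV. Mv i * (w $ i)\<^sup>2 / 2) \<ge> 0" and th: "(\<Sum>i\<in>UNIV. (th $ i - price)\<^sup>2 / 2) \<ge> 0"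
      by (auto intro!: sum_nonneg mult_nonneg_nonneg simp: less_imp_le[OF pos(1)])
    have 0: "energy xbar = potential etabar Vbar" by (simp add: energy_def xbar_def)
    \<comment> \<open>If \<open>(e, V)\<close> stays put, the potential gives only equality, and
      strictness comes from the quadratic term in \<open>w\<close> or in \<open>th\<close>.\<close>
    consider "(e, V) \<noteq> (etabar, Vbar)" | i where "w $ i \<noteq> 0" | i where "th $ i \<noteq> price"
      using y(2) by (auto simp: xbar_def vec_eq_iff)
    then show "energy xbar < energy y"
    proof cases
      case 1
      then show ?thesis using r(2)[OF near] w th 0 by (simp add: energy_def)
    next
      case 2
      have "(\<Sum>i\<in>UNIV. Mv i * (w $ i)\<^sup>2 / 2) > 0"
        using 2 pos(1) by (intro sum_pos2[of _ i]) (auto simp: less_imp_le)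
      then show ?thesis using pot th 0 by (simp add: energy_def)
    next
      case 3
      have "(\<Sum>i\<in>UNIV. (th $ i - price)\<^sup>2 / 2) > 0"
        using 3 by (intro sum_pos2[of _ i]) auto
      then show ?thesis using pot w 0 by (simp add: energy_def)
    qed
  qed
qed

section \<open>Convergence\<close>

lemma lipschitz_coords:
  "lipschitz_on_balls (\<lambda>y :: (real^'m) \<times> (real^'n) \<times> (real^'n) \<times> (real^'n). fst y $ k)"
  "lipschitz_on_balls (\<lambda>y :: (real^'m) \<times> (real^'n) \<times> (real^'n) \<times> (real^'n). fst (snd y) $ i)"
  "lipschitz_on_balls (\<lambda>y :: (real^'m) \<times> (real^'n) \<times> (real^'n) \<times> (real^'n). fst (snd (snd y)) $ i)"
  "lipschitz_on_balls (\<lambda>y :: (real^'m) \<times> (real^'n) \<times> (real^'n) \<times> (real^'n). snd (snd (snd y)) $ i)"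
  by (intro lipschitz_on_balls_linear bounded_linear_compose[OF bounded_linear_vec_nth]
      bounded_linear_fst bounded_linear_compose[OF bounded_linear_fst]
      bounded_linear_snd bounded_linear_compose[OF bounded_linear_snd])+

lemmas lipschitz_rules = lipschitz_on_balls_intros lipschitz_on_balls_divide_const
  lipschitz_on_balls_uminus lipschitz_on_balls_if lipschitz_coords

text \<open>With projections in place of tuple patterns, each component is built from coordinates by
  sums, products, sine and cosine, so the closure rules apply mechanically.\<close>

lemma field_lipschitz: "lipschitz_on_balls field"
proof -
  have eq: "field = (\<lambda>y. (\<chi> k. fst (snd y) $ src k - fst (snd y) $ dst k,
     \<chi> i. (snd (snd (snd y)) $ i / q i - (\<Sum>k\<in>UNIV. inc i k * flow (fst y) (fst (snd (snd y))) k)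
        - Av i * fst (snd y) $ i - Pl $ i) / Mv i,
     \<chi> i. (Efd $ i - EV (fst y) (fst (snd (snd y))) i) / Tv i,
     \<chi> i. (\<Sum>j\<in>{j. Ec i j}. snd (snd (snd y)) $ j - snd (snd (snd y)) $ i) - fst (snd y) $ i / q i))"
    using field_eq by (auto simp: fun_eq_iff)
  show ?thesis
    unfolding eq flow_def EV_def by (intro lipschitz_rules)
qed

lemma rate_lipschitz: "lipschitz_on_balls rate"
proof -
  have eq: "rate = (\<lambda>y. - (\<Sum>i\<in>UNIV. Av i * (fst (snd y) $ i)\<^sup>2)
    - (\<Sum>i\<in>UNIV. (Efd $ i - EV (fst y) (fst (snd (snd y))) i)\<^sup>2 / Tv i)
    - (\<Sum>i\<in>UNIV. \<Sum>j\<in>{j. Ec i j}. (snd (snd (snd y)) $ j - snd (snd (snd y)) $ i)\<^sup>2) / 2)"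
    by (auto simp: rate_def fun_eq_iff)
  show ?thesis
    unfolding eq EV_def power2_eq_square by (intro lipschitz_rules)
qed

lemma energy_continuous: "continuous_on S energy"
proof -
  have eq: "energy = (\<lambda>y. (\<Sum>i\<in>UNIV. Mv i * (fst (snd y) $ i)\<^sup>2 / 2)
    + (\<Sum>i\<in>UNIV. (snd (snd (snd y)) $ i - price)\<^sup>2 / 2) + potential (fst y) (fst (snd (snd y))))"
    by (auto simp: energy_def fun_eq_iff)
  show ?thesis
    unfolding eq potential_def by (intro continuous_intros) simp_all
qed

lemma sum_inv_q_pos: "(\<Sum>j\<in>UNIV. 1 / q j) > 0"
  using pos(4) by (intro sum_pos) auto

text \<open>The dissipation controls \<open>w\<close>, the voltage residual and the differences of
  \<open>\<theta>\<close> across communication edges, but neither the power balance nor the level of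
  \<open>\<theta>\<close>. The balance is reached through the derivative of \<open>w\<close>, the
  level through conservation of power in the network.\<close>

lemma trapped_asymptotics:
  assumes sol: "is_solution field {0..} x" and bd: "\<And>t. t \<ge> 0 \<Longrightarrow> x t \<in> cball c r"
  shows "((\<lambda>t. field (x t)) \<longlongrightarrow> 0) at_top"
    and "((\<lambda>t. fst (snd (x t))) \<longlongrightarrow> 0) at_top"
    and "((\<lambda>t. snd (snd (snd (x t)))) \<longlongrightarrow> (\<chi> i. price)) at_top"
proof -
  have der: "(x has_vector_derivative field (x t)) (at t within {0..})" if "t \<ge> 0" for t
    using sol that by (simp add: is_solution_def)
  obtain K where K: "K-lipschitz_on {0..} x"
    using solution_lipschitz[OF field_lipschitz sol bd] by blast
  define e w V th where "e t = fst (x t)" and "w t = fst (snd (x t))"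
    and "V t = fst (snd (snd (x t)))" and "th t = snd (snd (snd (x t)))" for t
  have x: "x t = (e t, w t, V t, th t)" for t
    by (simp add: e_def w_def V_def th_def)
  have der_energy: "((\<lambda>t. energy (x t)) has_vector_derivative rate (x t)) (at t within {0..})"
    if "t \<ge> 0" for t
    by (rule energy_has_derivative[OF der[OF that]])
  have "\<exists>l. ((\<lambda>t. energy (x t)) \<longlongrightarrow> l) at_top"
  proof -
    have "compact (energy ` cball c r)"
      by (intro compact_continuous_image energy_continuous compact_cball)
    then obtain C where C: "\<And>z. z \<in> cball c r \<Longrightarrow> norm (energy z) \<le> C"
      by (meson bounded_iff compact_imp_bounded imageI)
    show ?thesis
    proof (rule antimono_bounded_tendsto)
      fix s t :: real assume "0 \<le> s" "s \<le> t"
      then show "energy (x t) \<le> energy (x s)"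
        using der_energy rate_nonpos
        by (intro has_vector_derivative_nonpos_imp_le[where J = "{0..}" and g = "\<lambda>t. energy (x t)"
            and g' = "\<lambda>t. rate (x t)"]) simp_all
    next
      fix t :: real assume "0 \<le> t"
      then show "- C \<le> energy (x t)" using C[OF bd[of t]] by (simp add: abs_le_iff)
    qed
  qed
  then obtain l where l: "((\<lambda>t. energy (x t)) \<longlongrightarrow> l) at_top" ..
  obtain L where "L-lipschitz_on {0..} (\<lambda>t. rate (x t))"
    using lipschitz_on_balls_comp_curve[OF rate_lipschitz K bd] by blast
  from barbalat[OF der_energy this l] have rate: "((\<lambda>t. rate (x t)) \<longlongrightarrow> 0) at_top" .
  \<comment> \<open>Each summand of \<open>- rate\<close> is nonnegative, hence dominated by the
    whole.\<close>
  have squeeze: "(g \<longlongrightarrow> 0) at_top"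
    if c: "c > 0" and le: "\<And>t. c * (g t)\<^sup>2 \<le> - rate (x t)" for c and g :: "real \<Rightarrow> real"
  proof -
    have "((\<lambda>t. c * (g t)\<^sup>2) \<longlongrightarrow> 0) at_top"
    proof (rule tendsto_sandwich[where f = "\<lambda>_. 0" and h = "\<lambda>t. - rate (x t)"])
      show "((\<lambda>t. - rate (x t)) \<longlongrightarrow> 0) at_top" using tendsto_minus[OF rate] by simp
      show "\<forall>\<^sub>F t in at_top. 0 \<le> c * (g t)\<^sup>2" using c by simp
    qed (use le in \<open>simp_all\<close>)
    from tendsto_mult[OF tendsto_const[of "1 / c"] this] have "((\<lambda>t. (g t)\<^sup>2) \<longlongrightarrow> 0) at_top"
      using c by simp
    from tendsto_real_sqrt[OF this] show ?thesis
      by (simp add: tendsto_rabs_zero_iff)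
  qed
  have rate_eq: "- rate (x t) = (\<Sum>i\<in>UNIV. Av i * (w t $ i)\<^sup>2)
      + (\<Sum>i\<in>UNIV. (Efd $ i - EV (e t) (V t) i)\<^sup>2 / Tv i)
      + (\<Sum>i\<in>UNIV. \<Sum>j\<in>{j. Ec i j}. (th t $ j - th t $ i)\<^sup>2) / 2" for t
    by (simp add: rate_def x)
  note nonneg = rate_terms_nonneg(1)[of "w t" for t]
    rate_terms_nonneg(2)[of "\<lambda>i. Efd $ i - EV (e t) (V t) i" for t] rate_terms_nonneg(3)[of "th t" for t]
  have w0: "((\<lambda>t. w t $ i) \<longlongrightarrow> 0) at_top" for i
  proof (rule squeeze[OF pos(2)[of i]])
    fix t
    have "Av i * (w t $ i)\<^sup>2 \<le> (\<Sum>i\<in>UNIV. Av i * (w t $ i)\<^sup>2)"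
      by (rule member_le_sum) (simp_all add: less_imp_le[OF pos(2)])
    then show "Av i * (w t $ i)\<^sup>2 \<le> - rate (x t)"
      unfolding rate_eq using nonneg[of t] by linarith
  qed
  have V0: "((\<lambda>t. Efd $ i - EV (e t) (V t) i) \<longlongrightarrow> 0) at_top" for i
  proof (rule squeeze)
    show "1 / Tv i > 0" using pos(3)[of i] by simp
    fix t
    have "(Efd $ i - EV (e t) (V t) i)\<^sup>2 / Tv i \<le> (\<Sum>i\<in>UNIV. (Efd $ i - EV (e t) (V t) i)\<^sup>2 / Tv i)"
      by (rule member_le_sum) (simp_all add: less_imp_le[OF pos(3)])
    then show "1 / Tv i * (Efd $ i - EV (e t) (V t) i)\<^sup>2 \<le> - rate (x t)"
      unfolding rate_eq using nonneg[of t] by simp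
  qed
  have adj0: "((\<lambda>t. th t $ j - th t $ i) \<longlongrightarrow> 0) at_top" if "Ec i j" for i j
  proof (rule squeeze[of "1 / 2"])
    fix t
    have "(th t $ j - th t $ i)\<^sup>2 \<le> (\<Sum>j\<in>{j. Ec i j}. (th t $ j - th t $ i)\<^sup>2)"
      by (rule member_le_sum[of j "{j. Ec i j}" "\<lambda>j. (th t $ j - th t $ i)\<^sup>2"]) (simp_all add: that)
    also have "\<dots> \<le> (\<Sum>i\<in>UNIV. \<Sum>j\<in>{j. Ec i j}. (th t $ j - th t $ i)\<^sup>2)"
      by (rule member_le_sum[of i UNIV "\<lambda>i. \<Sum>j\<in>{j. Ec i j}. (th t $ j - th t $ i)\<^sup>2"])
        (simp_all add: sum_nonneg)
    finally show "1 / 2 * (th t $ j - th t $ i)\<^sup>2 \<le> - rate (x t)"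
      unfolding rate_eq using nonneg[of t] by simp
  qed simp
  have th_diff: "((\<lambda>t. th t $ i - th t $ j) \<longlongrightarrow> 0) at_top" for i j
  proof -
    \<comment> \<open>Agreement across single communication edges spreads along a path from
      \<open>i\<close> to \<open>j\<close>.\<close>
    have "(i, j) \<in> {(a, b). Ec a b}\<^sup>*"
      using Ec_connected by (simp add: graph_connected_def)
    then show ?thesis
    proof (induction rule: rtrancl_induct)
      case base
      show ?case by simp
    next
      case (step j k)
      have "((\<lambda>t. (th t $ i - th t $ j) - (th t $ k - th t $ j)) \<longlongrightarrow> 0 - 0) at_top"
        by (rule tendsto_diff[OF step.IH adj0]) (use step.hyps in simp)
      then show ?case by simp
    qed
  qed
  define w' where "w' t i = (th t $ i / q i - (\<Sum>k\<in>UNIV. inc i k * flow (e t) (V t) k) - Av i * w t $ i - Pl $ i) / Mv i" for t i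
  have field: "field (x t) = (\<chi> k. w t $ src k - w t $ dst k, \<chi> i. w' t i,
     \<chi> i. (Efd $ i - EV (e t) (V t) i) / Tv i,
     \<chi> i. (\<Sum>j\<in>{j. Ec i j}. th t $ j - th t $ i) - w t $ i / q i)" for t
    unfolding x field_eq w'_def ..
  have w'0: "((\<lambda>t. w' t i) \<longlongrightarrow> 0) at_top" for i
  proof -
    obtain L where L: "L-lipschitz_on {0..} (\<lambda>t. field (x t))"
      using lipschitz_on_balls_comp_curve[OF field_lipschitz K bd] by blast
    have bl: "bounded_linear (\<lambda>y :: (real^'m) \<times> (real^'n) \<times> (real^'n) \<times> (real^'n). fst (snd y) $ i)"
      by (intro bounded_linear_compose[OF bounded_linear_vec_nth]
          bounded_linear_compose[OF bounded_linear_fst] bounded_linear_snd)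
    obtain M where M: "M-lipschitz_on UNIV (\<lambda>y :: (real^'m) \<times> (real^'n) \<times> (real^'n) \<times> (real^'n). fst (snd y) $ i)"
      using bounded_linear.lipschitz_boundE[OF bl] by blast
    have lip: "(M * L)-lipschitz_on {0..} (\<lambda>t. w' t i)"
      using lipschitz_on_compose2[OF L lipschitz_on_subset[OF M subset_UNIV]]
      unfolding field by simp
    show ?thesis
    proof (rule barbalat[OF _ lip w0[of i]])
      fix t :: real assume "t \<ge> 0"
      from bounded_linear.has_vector_derivative[OF bl der[OF this]]
      show "((\<lambda>t. w t $ i) has_vector_derivative w' t i) (at t within {0..})"
        unfolding field by (simp add: w_def)
    qed
  qed
  have price_lim: "((\<lambda>t. th t $ i) \<longlongrightarrow> price) at_top" for i
  proof -
    \<comment> \<open>Every line takes from one end what it delivers to the other, so the flows drop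
      out of the total. What is left determines \<open>th t $ i\<close> up to terms that tend to
      zero.\<close>
    have "(\<Sum>j\<in>UNIV. Mv j * w' t j) = (\<Sum>j\<in>UNIV. th t $ j / q j) - (\<Sum>j\<in>UNIV. Av j * w t $ j)
       - (\<Sum>j\<in>UNIV. Pl $ j)" for t
    proof -
      have "Mv j * w' t j = th t $ j / q j - 1 * (\<Sum>k\<in>UNIV. inc j k * flow (e t) (V t) k)
         - Av j * w t $ j - Pl $ j" for j
        using pos(1)[of j] by (simp add: w'_def)
      then show ?thesis
        by (simp only: sum_subtractf sum_mult_sum_inc[of "\<lambda>_. 1"]) simp
    qed
    then have "th t $ i * (\<Sum>j\<in>UNIV. 1 / q j) = (\<Sum>j\<in>UNIV. (th t $ i - th t $ j) / q j)
      + (\<Sum>j\<in>UNIV. Mv j * w' t j) + (\<Sum>j\<in>UNIV. Av j * w t $ j) + (\<Sum>j\<in>UNIV. Pl $ j)" for t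
      by (simp add: diff_divide_distrib sum_subtractf sum_distrib_left)
    moreover have "((\<lambda>t. (\<Sum>j\<in>UNIV. (th t $ i - th t $ j) / q j)
      + (\<Sum>j\<in>UNIV. Mv j * w' t j) + (\<Sum>j\<in>UNIV. Av j * w t $ j) + (\<Sum>j\<in>UNIV. Pl $ j)) \<longlongrightarrow>
      (\<Sum>j\<in>UNIV. 0 / q j) + (\<Sum>j\<in>UNIV. Mv j * 0) + (\<Sum>j\<in>UNIV. Av j * 0) + (\<Sum>j\<in>UNIV. Pl $ j)) at_top"
      by (intro tendsto_intros th_diff w'0 w0) (use pos(4) in \<open>simp add: less_imp_neq[symmetric]\<close>)
    ultimately have "((\<lambda>t. th t $ i * (\<Sum>j\<in>UNIV. 1 / q j)) \<longlongrightarrow> (\<Sum>j\<in>UNIV. Pl $ j)) at_top"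
      by simp
    from tendsto_divide[OF this tendsto_const, of "\<Sum>j\<in>UNIV. 1 / q j"] sum_inv_q_pos
    show ?thesis by (simp add: price_def)
  qed
  have q0: "q i \<noteq> 0" "Tv i \<noteq> 0" for i using pos(4)[of i] pos(3)[of i] by simp_all
  have a: "((\<lambda>t. \<chi> k. w t $ src k - w t $ dst k) \<longlongrightarrow> (0 :: real^'m)) at_top"
    by (rule vec_tendstoI) (use tendsto_diff[OF w0 w0] in simp)
  have b: "((\<lambda>t. \<chi> i. w' t i) \<longlongrightarrow> (0 :: real^'n)) at_top"
    by (rule vec_tendstoI) (use w'0 in simp)
  have c: "((\<lambda>t. \<chi> i. (Efd $ i - EV (e t) (V t) i) / Tv i) \<longlongrightarrow> (0 :: real^'n)) at_top"
    by (rule vec_tendstoI) (use tendsto_divide[OF V0 tendsto_const q0(2)] in simp)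
  have d: "((\<lambda>t. \<chi> i. (\<Sum>j\<in>{j. Ec i j}. th t $ j - th t $ i) - w t $ i / q i) \<longlongrightarrow> (0 :: real^'n)) at_top"
  proof (rule vec_tendstoI)
    fix i
    have "((\<lambda>t. (\<Sum>j\<in>{j. Ec i j}. th t $ j - th t $ i) - w t $ i / q i) \<longlongrightarrow>
      (\<Sum>j\<in>{j. Ec i j}. 0) - 0 / q i) at_top"
      by (intro tendsto_diff tendsto_sum th_diff tendsto_divide w0 tendsto_const q0)
    then show "((\<lambda>t. (\<chi> i. (\<Sum>j\<in>{j. Ec i j}. th t $ j - th t $ i) - w t $ i / q i) $ i) \<longlongrightarrow> (0 :: real^'n) $ i) at_top"
      by simp
  qed
  show "((\<lambda>t. field (x t)) \<longlongrightarrow> 0) at_top"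
    unfolding field zero_prod_def by (intro tendsto_Pair a b c d)
  have "((\<lambda>t. w t) \<longlongrightarrow> 0) at_top"
    by (rule vec_tendstoI) (use w0 in simp)
  then show "((\<lambda>t. fst (snd (x t))) \<longlongrightarrow> 0) at_top" by (simp only: w_def)
  have "((\<lambda>t. th t) \<longlongrightarrow> (\<chi> i. price)) at_top"
    by (rule vec_tendstoI) (use price_lim in simp)
  then show "((\<lambda>t. snd (snd (snd (x t)))) \<longlongrightarrow> (\<chi> i. price)) at_top" by (simp only: th_def)
qed

section \<open>Rest points and the largest invariant set\<close>

text \<open>Spelled with the quotient instead of \<open>price\<close>, so that it coincides
  literally with the set in the theorem.\<close>

abbreviation "Z \<equiv> {(eta, w, V, th). w = 0 \<and> Emat src dst B Xd Xd' eta *v V - Efd = 0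
  \<and> th = (\<chi> i. (\<Sum>j\<in>UNIV. Pl $ j) / (\<Sum>j\<in>UNIV. 1 / q j))}"

text \<open>A continuous function whose zeros are exactly the rest points lying in \<open>Z\<close>;
  as a sum of norms it tends to zero along a curve as soon as each part does.\<close>

definition "defect y = norm (field y) + norm (fst (snd y)) + norm (snd (snd (snd y)) - (\<chi> i. price))"

lemma defect_zero_subset: "{y. defect y = 0} \<subseteq> largest_invariant_subset field Z"
proof
  fix y assume "y \<in> {y. defect y = 0}"
  then have "norm (field y) + norm (fst (snd y)) + norm (snd (snd (snd y)) - (\<chi> i. price)) = 0"
    by (simp add: defect_def)
  then have 1: "field y = 0" and 2: "fst (snd y) = 0" and 3: "snd (snd (snd y)) = (\<chi> i. price)"
    by (simp_all add: add_nonneg_eq_0_iff)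
  obtain e w V th where y: "y = (e, w, V, th)" by (metis prod.collapse)
  have "(\<chi> i. (Efd $ i - EV e V i) / Tv i) = 0"
    using 1 unfolding y field_eq zero_prod_def by simp
  then have "(Efd $ i - EV e V i) / Tv i = 0" for i
    by (simp add: vec_eq_iff)
  then have "Efd $ i = EV e V i" for i
    by (metis pos(3) divide_eq_0_iff eq_iff_diff_eq_0 less_irrefl)
  then have "Emat src dst B Xd Xd' e *v V - Efd = 0"
    by (simp add: vec_eq_iff Emat_mult)
  then have "{y} \<subseteq> Z"
    using 2 3 by (simp add: y price_def)
  moreover have "invariant_set field {y}"
    by (rule equilibrium_invariant[OF field_lipschitz 1])
  ultimately show "y \<in> largest_invariant_subset field Z"
    unfolding largest_invariant_subset_def by blast
qed

lemma defect_xbar: "defect xbar = 0"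
proof -
  have "(price / q i - (\<Sum>k\<in>UNIV. inc i k * flow etabar Vbar k) - Pl $ i) = 0" for i
    using power_balance'[of i] by simp
  then have "field xbar = 0"
    by (simp add: xbar_def field_eq voltage_balance' zero_prod_def vec_eq_iff)
  then show ?thesis by (simp add: defect_def xbar_def)
qed

lemma defect_continuous: "continuous_on S defect"
  unfolding defect_def
  by (intro continuous_intros lipschitz_on_balls_continuous field_lipschitz)

text \<open>Membership in \<open>Z\<close> does not contain the power balance. It comes from
  invariance: a solution started at the point keeps \<open>w = 0\<close> for a while, so the
  derivative of \<open>w\<close> vanishes at time 0. Such a solution has to be produced, which the
  truncated field does for a short time.\<close>

lemma largest_invariant_balance:
  assumes "(e, w, V, th) \<in> largest_invariant_subset field Z"
  shows "w = 0" "Emat src dst B Xd Xd' e *v V - Efd = 0" "th = (\<chi> i. price)"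
    "price / q i - (\<Sum>k\<in>UNIV. inc i k * flow e V k) - Pl $ i = 0"
proof -
  obtain S where S: "(e, w, V, th) \<in> S" "S \<subseteq> Z" "invariant_set field S"
    using assms unfolding largest_invariant_subset_def by blast
  show w: "w = 0" and "Emat src dst B Xd Xd' e *v V - Efd = 0" and th: "th = (\<chi> i. price)"
    using S by (auto simp: price_def)
  let ?p = "(e, w, V, th)"
  obtain x where x0: "x 0 = ?p" and x: "\<And>t. t \<ge> 0 \<Longrightarrow> \<exists>v. (x has_vector_derivative v) (at t within {0..}) \<and>
      (x t \<in> cball ?p 1 \<longrightarrow> v = field (x t))"
    using truncated_solution_exists[OF field_lipschitz zero_less_one, of ?p ?p] by blast
  have "continuous (at 0 within {0..}) x"
    using x[of 0] has_vector_derivative_continuous by blast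
  then obtain d where d: "d > 0" "\<And>t. t \<in> {0..} \<Longrightarrow> dist t 0 < d \<Longrightarrow> dist (x t) (x 0) < 1"
    unfolding continuous_within_eps_delta by (metis zero_less_one)
  \<comment> \<open>Half of \<open>d\<close>, so that the closed interval satisfies the strict bound
    \<open>dist t 0 < d\<close> and the curve stays in the unit ball, where truncation changes
    nothing.\<close>
  define h where "h = d / 2"
  have h: "h > 0" "h < d" using d(1) by (simp_all add: h_def)
  have sol: "is_solution field {0..h} x"
    unfolding is_solution_def
  proof (intro conjI ballI)
    show "is_interval {0..h}" by (rule is_interval_cc)
    fix t assume t: "t \<in> {0..h}"
    then have "x t \<in> cball ?p 1"
      using d(2)[of t] h x0 by (simp add: dist_commute)
    moreover obtain v where v: "(x has_vector_derivative v) (at t within {0..})"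
      "x t \<in> cball ?p 1 \<longrightarrow> v = field (x t)"
      using x[of t] t by auto
    moreover have "(x has_vector_derivative v) (at t within {0..h})"
      by (rule has_vector_derivative_within_subset[OF v(1)]) auto
    ultimately show "(x has_vector_derivative field (x t)) (at t within {0..h})" by simp
  qed
  have "0 \<in> {0..h} \<and> is_solution field {0..h} x \<and> x 0 \<in> S"
    using sol S(1) h(1) by (simp add: x0)
  then have inS: "x t \<in> S" if "t \<in> {0..h}" for t
    using S(3) that unfolding invariant_set_def by blast
  have "(x has_vector_derivative field ?p) (at 0 within {0..h})"
    using sol h(1) x0 unfolding is_solution_def by (metis atLeastAtMost_iff less_imp_le order_refl)
  from bounded_linear.has_vector_derivative[OF bounded_linear_fst
      bounded_linear.has_vector_derivative[OF bounded_linear_snd this]]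
  have 1: "((\<lambda>t. fst (snd (x t))) has_vector_derivative fst (snd (field ?p))) (at 0 within {0..h})" .
  have z: "fst (snd (x t)) = 0" if "t \<in> {0..h}" for t
    using inS[OF that] S(2) by (cases "x t") auto
  have 2: "((\<lambda>t. fst (snd (x t))) has_vector_derivative 0) (at 0 within {0..h})"
    by (rule has_vector_derivative_transform[OF _ z has_vector_derivative_const]) (use h in auto)
  \<comment> \<open>One-sided derivatives are unique only at a limit point of the interval.\<close>
  have "at 0 within {0..h} \<noteq> bot"
    using h(1) by (simp add: trivial_limit_within islimpt_Icc)
  from vector_derivative_unique_within[OF this 1 2]
  have "fst (snd (field ?p)) $ i = 0" by simp
  then show "price / q i - (\<Sum>k\<in>UNIV. inc i k * flow e V k) - Pl $ i = 0"
    using pos(1)[of i] w th by (simp add: field_eq)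
qed

text \<open>The least energy on a small sphere exceeds the energy at its centre, and the points of
  the ball below that level form the neighbourhood. The radius is halved because strictness of the
  minimum is known on an open ball only, and the sphere has to lie in it.\<close>

lemma trapping_neighbourhood:
  "\<exists>U r. open U \<and> xbar \<in> U \<and> r > 0 \<and> (\<forall>y\<in>U. y \<in> ball xbar r \<and> (\<forall>z\<in>sphere xbar r. energy y < energy z))"
proof -
  obtain r where r: "r > 0" "\<And>y. dist y xbar < r \<Longrightarrow> y \<noteq> xbar \<Longrightarrow> energy xbar < energy y"
    using energy_min by blast
  let ?S = "sphere xbar (r / 2)"
  have "\<exists>z\<in>?S. \<forall>y\<in>?S. energy z \<le> energy y"
    using r(1) by (intro continuous_attains_inf compact_sphere energy_continuous) simp
  then obtain z where z: "z \<in> ?S" "\<And>y. y \<in> ?S \<Longrightarrow> energy z \<le> energy y" by blast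
  have "dist z xbar = r / 2" using z(1) by (simp add: dist_commute)
  then have m: "energy xbar < energy z" using r by (intro r(2)) auto
  show ?thesis
  proof (intro exI conjI ballI)
    show "open (ball xbar (r / 2) \<inter> {y. energy y < energy z})"
      by (intro open_Int open_ball open_Collect_less continuous_on_const energy_continuous)
    show "xbar \<in> ball xbar (r / 2) \<inter> {y. energy y < energy z}" using r(1) m by simp
    show "r / 2 > 0" using r(1) by simp
  next
    fix y y' assume "y \<in> ball xbar (r / 2) \<inter> {y. energy y < energy z}" "y' \<in> ?S"
    then show "energy y < energy y'" using z(2)[of y'] by simp
  qed simp
qed

lemma local_convergence:
  "\<exists>U. open U \<and> xbar \<in> U \<and> (\<forall>x0\<in>U. (\<exists>x. is_solution field {0..} x \<and> x 0 = x0) \<and>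
    (\<forall>x. is_solution field {0..} x \<and> x 0 = x0 \<longrightarrow>
      ((\<lambda>t. infdist (x t) (largest_invariant_subset field Z)) \<longlongrightarrow> 0) at_top \<and>
      ((\<lambda>t. fst (snd (x t))) \<longlongrightarrow> 0) at_top \<and>
      ((\<lambda>t. snd (snd (snd (x t)))) \<longlongrightarrow> (\<chi> i. price)) at_top))"
proof -
  obtain U r where U: "open U" "xbar \<in> U" and r: "r > 0"
    and U': "\<And>y. y \<in> U \<Longrightarrow> y \<in> ball xbar r"
    and less: "\<And>y z. y \<in> U \<Longrightarrow> z \<in> sphere xbar r \<Longrightarrow> energy y < energy z"
    using trapping_neighbourhood by blast
  \<comment> \<open>Stated for curves that obey the equation only while in the ball, so that it is
    available before any global solution is known to exist.\<close>
  have trap: "x t \<in> ball xbar r"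
    if x0: "x 0 \<in> U" and der: "\<And>t. t \<ge> 0 \<Longrightarrow> \<exists>v. (x has_vector_derivative v) (at t within {0..}) \<and>
      (x t \<in> cball xbar r \<longrightarrow> v = field (x t))" and t: "t \<ge> 0" for x t
  proof (rule trapped_in_ball[where W = energy and N = rate, OF der _ rate_nonpos U'[OF x0] less[OF x0] t])
    fix I x t assume "is_solution field I x" "t \<in> I"
    then show "((\<lambda>t. energy (x t)) has_vector_derivative rate (x t)) (at t within I)"
      by (intro energy_has_derivative) (simp add: is_solution_def)
  qed
  have exist: "\<exists>x. is_solution field {0..} x \<and> x 0 = x0" if "x0 \<in> U" for x0
  proof -
    obtain x where x0: "x 0 = x0" and x: "\<And>t. t \<ge> 0 \<Longrightarrow> \<exists>v. (x has_vector_derivative v) (at t within {0..}) \<and>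
      (x t \<in> cball xbar r \<longrightarrow> v = field (x t))"
      using truncated_solution_exists[OF field_lipschitz r, of x0 xbar] by blast
    have "is_solution field {0..} x"
      unfolding is_solution_def
    proof (intro conjI ballI)
      show "is_interval {0::real..}" by (rule is_interval_ci)
      fix t :: real assume "t \<in> {0..}"
      then have t: "t \<ge> 0" by simp
      have "x t \<in> ball xbar r" by (rule trap[OF _ x t]) (simp add: x0 that)
      then have "x t \<in> cball xbar r" by simp
      then show "(x has_vector_derivative field (x t)) (at t within {0..})"
        using x[OF t] by blast
    qed
    then show ?thesis using x0 by blast
  qed
  have conv: "((\<lambda>t. infdist (x t) (largest_invariant_subset field Z)) \<longlongrightarrow> 0) at_top \<and>
      ((\<lambda>t. fst (snd (x t))) \<longlongrightarrow> 0) at_top \<and>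
      ((\<lambda>t. snd (snd (snd (x t)))) \<longlongrightarrow> (\<chi> i. price)) at_top"
    if sol: "is_solution field {0..} x" and x0: "x 0 \<in> U" for x
  proof -
    have der: "\<exists>v. (x has_vector_derivative v) (at t within {0..}) \<and>
      (x t \<in> cball xbar r \<longrightarrow> v = field (x t))" if "t \<ge> 0" for t
      using sol that unfolding is_solution_def by (intro exI[of _ "field (x t)"]) simp
    have bd: "x t \<in> cball xbar r" if "t \<ge> 0" for t
      using trap[OF x0 der that] by simp
    note lim = trapped_asymptotics[OF sol bd]
    have "((\<lambda>t. defect (x t)) \<longlongrightarrow> norm (0 :: (real^'m) \<times> (real^'n) \<times> (real^'n) \<times> (real^'n)) + norm (0 :: real^'n) + norm ((\<chi> i. price) - (\<chi> i. price) :: real^'n)) at_top"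
      unfolding defect_def by (intro tendsto_add tendsto_norm tendsto_diff lim tendsto_const)
    then have "((\<lambda>t. defect (x t)) \<longlongrightarrow> 0) at_top" by simp
    then have 0: "((\<lambda>t. infdist (x t) {y. defect y = 0}) \<longlongrightarrow> 0) at_top"
      by (intro infdist_zero_set_tendsto[OF compact_cball bd defect_continuous])
        (simp_all add: defect_def)
    have "((\<lambda>t. infdist (x t) (largest_invariant_subset field Z)) \<longlongrightarrow> 0) at_top"
    proof (rule tendsto_sandwich[OF _ _ tendsto_const 0])
      show "\<forall>\<^sub>F t in at_top. 0 \<le> infdist (x t) (largest_invariant_subset field Z)"
        by (simp add: infdist_nonneg)
      \<comment> \<open>Enlarging a set decreases the distance only if the smaller set is nonempty,
        since the distance to the empty set is 0 by convention; \<open>xbar\<close> is the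
        witness.\<close>
      have "infdist (x t) (largest_invariant_subset field Z) \<le> infdist (x t) {y. defect y = 0}" for t
        by (rule infdist_mono[OF defect_zero_subset]) (use defect_xbar in blast)
      then show "\<forall>\<^sub>F t in at_top. infdist (x t) (largest_invariant_subset field Z) \<le> infdist (x t) {y. defect y = 0}"
        by simp
    qed
    then show ?thesis using lim by simp
  qed
  show ?thesis
    using U exist conv by (intro exI[of _ U]) blast
qed

end

theorem theorem2:
  fixes src dst :: "'m::finite \<Rightarrow> 'n::finite"
    and B :: "'n \<Rightarrow> 'n \<Rightarrow> real"
    and Xd Xd' Mv Av Tv q :: "'n \<Rightarrow> real"
    and Efd Pl Vbar :: "real^'n"
    and etabar :: "real^'m"
    and Ec :: "'n \<Rightarrow> 'n \<Rightarrow> bool"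
  defines "D \<equiv> incidence src dst"
    and "thbar \<equiv> (\<chi> i. (\<Sum>j\<in>UNIV. Pl $ j) / (\<Sum>j\<in>UNIV. 1 / q j))"
    and "ubar \<equiv> (\<chi> i. (\<Sum>j\<in>UNIV. Pl $ j) / (\<Sum>j\<in>UNIV. 1 / q j) / q i)"
    and "f \<equiv> cl_field src dst B Xd Xd' Mv Av Tv Efd Pl Ec q"
    and "Z \<equiv> {(eta, w, V, th). w = 0 \<and> Emat src dst B Xd Xd' eta *v V - Efd = 0 \<and> th = (\<chi> i. (\<Sum>j\<in>UNIV. Pl $ j) / (\<Sum>j\<in>UNIV. 1 / q j))}"
  assumes "\<forall>k. src k \<noteq> dst k"
    and "inj (\<lambda>k. {src k, dst k})"
    and "graph_connected (edge_adj src dst)"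
    and "\<forall>i j. B i j = B j i"
    and "\<forall>i j. edge_adj src dst i j \<longrightarrow> B i j > 0"
    and "\<forall>i. B i i < 0 \<and> \<bar>B i i\<bar> > (\<Sum>j\<in>{j. edge_adj src dst i j}. \<bar>B i j\<bar>)"
    and "\<forall>i. Xd i > Xd' i \<and> Xd' i > 0"
    and "\<forall>i. Mv i > 0 \<and> Av i > 0 \<and> Tv i > 0"
    and "\<forall>i. q i > 0"
    and "\<exists>\<phi>. etabar = transpose D *v \<phi>"
    and "\<forall>k. - (pi / 2) < etabar $ k \<and> etabar $ k < pi / 2"
    and "\<forall>i. Vbar $ i > 0"
    and "ubar - Pl = D *v (Gamma src dst B Vbar *v vsin etabar)"
    and "Emat src dst B Xd Xd' etabar *v Vbar = Efd"
    and "cond_star src dst B Xd Xd' etabar Vbar"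
    and "\<forall>i j. Ec i j = Ec j i"
    and "\<forall>i. \<not> Ec i i"
    and "graph_connected Ec"
  shows "\<exists>U. open U \<and> (etabar, 0, Vbar, thbar) \<in> U \<and>
     (\<forall>x0\<in>U. (\<exists>x. is_solution f {0..} x \<and> x 0 = x0) \<and>
        (\<forall>x. is_solution f {0..} x \<and> x 0 = x0 \<longrightarrow>
           ((\<lambda>t. infdist (x t) (largest_invariant_subset f Z)) \<longlongrightarrow> 0) at_top \<and>
           ((\<lambda>t. fst (snd (x t))) \<longlongrightarrow> 0) at_top \<and>
           ((\<lambda>t. (\<chi> i. snd (snd (snd (x t))) $ i / q i)) \<longlongrightarrow> ubar) at_top)) \<and>
     (\<forall>(eta, w, V, th) \<in> largest_invariant_subset f Z.
        w = 0 \<and> Emat src dst B Xd Xd' eta *v V - Efd = 0 \<and> th = thbar \<and>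
        ubar - D *v (Gamma src dst B V *v vsin eta) - Pl = 0)"
proof -
  interpret power_network src dst B Xd Xd' Mv Av Tv q Efd Pl Vbar etabar Ec
    by unfold_locales (use assms(6-) in \<open>auto simp: D_def ubar_def\<close>)
  have thbar: "thbar = (\<chi> i. price)" by (simp add: thbar_def price_def)
  have f: "f = field" by (simp add: f_def)
  obtain U where U: "open U" "xbar \<in> U"
    and ex: "\<And>x0. x0 \<in> U \<Longrightarrow> \<exists>x. is_solution f {0..} x \<and> x 0 = x0"
    and conv: "\<And>x. is_solution f {0..} x \<Longrightarrow> x 0 \<in> U \<Longrightarrow>
      ((\<lambda>t. infdist (x t) (largest_invariant_subset f Z)) \<longlongrightarrow> 0) at_top \<and>
      ((\<lambda>t. fst (snd (x t))) \<longlongrightarrow> 0) at_top \<and>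
      ((\<lambda>t. snd (snd (snd (x t)))) \<longlongrightarrow> (\<chi> i. price)) at_top"
    using local_convergence unfolding f Z_def by blast
  have ulim: "((\<lambda>t. \<chi> i. snd (snd (snd (x t))) $ i / q i) \<longlongrightarrow> ubar) at_top"
    if "((\<lambda>t. snd (snd (snd (x t)))) \<longlongrightarrow> (\<chi> i. price)) at_top" for x :: "real \<Rightarrow> (real^'m) \<times> (real^'n) \<times> (real^'n) \<times> (real^'n)"
  proof (rule vec_tendstoI)
    fix i
    have "q i \<noteq> 0" using pos(4)[of i] by simp
    from tendsto_divide[OF tendsto_vec_nth[OF that] tendsto_const this, of i]
    show "((\<lambda>t. (\<chi> i. snd (snd (snd (x t))) $ i / q i) $ i) \<longlongrightarrow> ubar $ i) at_top"
      by (simp add: ubar_def price_def)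
  qed
  have bal: "w = 0 \<and> Emat src dst B Xd Xd' eta *v V - Efd = 0 \<and> th = thbar \<and>
      ubar - D *v (Gamma src dst B V *v vsin eta) - Pl = 0"
    if "(eta, w, V, th) \<in> largest_invariant_subset f Z" for eta w V th
  proof -
    note L = largest_invariant_balance[OF that[unfolded f Z_def]]
    have "ubar - D *v (Gamma src dst B V *v vsin eta) - Pl = 0"
      using L(4) by (simp add: vec_eq_iff D_def incidence_mult Gamma_mult ubar_def price_def)
    then show ?thesis using L(1-3) thbar by simp
  qed
  show ?thesis
  proof (intro exI[of _ U] conjI ballI allI impI)
    show "open U" by (rule U)
    show "(etabar, 0, Vbar, thbar) \<in> U" using U(2) by (simp add: xbar_def thbar)
    show "\<exists>x. is_solution f {0..} x \<and> x 0 = x0" if "x0 \<in> U" for x0 by (rule ex[OF that])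
  next
    fix x0 x assume "x0 \<in> U" "is_solution f {0..} x \<and> x 0 = x0"
    then have "is_solution f {0..} x" "x 0 \<in> U" by simp_all
    note lim = conv[OF this]
    show "((\<lambda>t. infdist (x t) (largest_invariant_subset f Z)) \<longlongrightarrow> 0) at_top"
      "((\<lambda>t. fst (snd (x t))) \<longlongrightarrow> 0) at_top" using lim by simp_all
    show "((\<lambda>t. (\<chi> i. snd (snd (snd (x t))) $ i / q i)) \<longlongrightarrow> ubar) at_top"
      using lim ulim by blast
  next
    fix y assume "y \<in> largest_invariant_subset f Z"
    then show "case y of (eta, w, V, th) \<Rightarrow> w = 0 \<and> Emat src dst B Xd Xd' eta *v V - Efd = 0 \<and> th = thbar \<and>
        ubar - D *v (Gamma src dst B V *v vsin eta) - Pl = 0"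
      using bal by (cases y) simp
  qed
qed

end
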